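(* Let $n\ge n_0$. Write $\Omega_n=\{i_1,\dots,i_{m_n}\}$, let $v_1,\dots,v_{m_n}$ be a Jordan basis of row vectors for $T_n$, let $\mathcal{B}_n$ be the (invertible) matrix whose rows are $v_1,\dots,v_{m_n}$, and let $\mathbf{h}:\mathbb{R}^d\to\mathbb{C}^{m_n}$ be the function $\mathbf{h}(x)=(h_{v_1}(x),\dots,h_{v_{m_n}}(x))^t\chi_Q(x)$, where $\chi_Q$ is the indicator function of $Q$. Then any function of the shift-invariant space $\mathcal{S}(\varphi)$ can be written as a linear combination of the lattice translates of the functions $h_{v_i}$ (restricted to $Q$). Namely, let $f\in\mathcal{S}(\varphi)$, $f(x)=\sum_{\gamma\in\Gamma}\alpha_\gamma\varphi(x+\gamma)$, $x\in\mathbb{R}^d$, with $\alpha_\gamma\in\mathbb{C}$, and for $\gamma\in\Gamma$ let $\overline{\alpha}_\gamma=(\alpha_{i_1+\gamma},\dots,\alpha_{i_{m_n}+\gamma})$. Then $$f(x)=\sum_{\gamma\in\Gamma}\beta_\gamma\,\mathbf{h}(x+\gamma),\qquad\text{where }\beta_\gamma=\overline{\alpha}_\gamma\mathcal{B}_n^{-1}.$$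
   Context: $\Gamma\subset\mathbb{R}^d$ is a lattice (the image of $\mathbb{Z}^d$ under a nonsingular linear map) and $A$ is a dilation matrix associated to $\Gamma$: a $d\times d$ real matrix with $A(\Gamma)\subset\Gamma$ all of whose eigenvalues have modulus $>1$. $\Lambda\subset\Gamma$ is finite, $c_k\in\mathbb{C}$ for $k\in\Lambda$, $c_k=0$ for $k\in\Gamma\setminus\Lambda$. $\varphi:\mathbb{R}^d\to\mathbb{C}$ is a compactly supported function satisfying $\varphi(x)=\sum_{k\in\Lambda}c_k\varphi(Ax-k)$ for $x\in\mathbb{R}^d$. $\ell(\Gamma)$ is the space of all complex sequences $Y=\{y_k\}_{k\in\Gamma}$ (row vectors). $\Phi(x)=\{\varphi(x+k)\}_{k\in\Gamma}$ is an infinite column vector, and $Y\Phi(x)=\sum_{k\in\Gamma}y_k\varphi(x+k)$. $\mathcal{S}(\varphi)=\{Y\Phi: Y\in\ell(\Gamma)\}$. $L=[c_{Ai-j}]_{i,j\in\Gamma}$ acts on row vectors by $(YL)_j=\sum_iy_ic_{Ai-j}$ (a finite sum for each $j$). For a finite nonempty $H\subset\Gamma$ and $B\subset\mathbb{R}^d$ let $w_H(B)=A^{-1}(B+H)$; $K_H$ is the unique nonempty compact set with $w_H(K_H)=K_H$, and $\Omega_H=K_H\cap\Gamma$. A set $\Omega\subset\Gamma$ is $H$-admissible if $w_H(\Omega)\cap\Gamma\subset\Omega$. $D\subset\Gamma$ is a full set of representatives of $\Gamma/A(\Gamma)$ with $0\in D$, and $Q=K_D$ is assumed to be a tile: the translates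 $Q+k$, $k\in\Gamma$, cover $\mathbb{R}^d$ with overlaps of measure zero. $\Lambda'=\Lambda-D$ and $\Omega'=K_{\Lambda'}\cap\Gamma$. $\{\Omega_n\}_{n\ge0}$ is a fixed sequence of finite subsets of $\Gamma$ such that: $\Omega_0=\Omega_\Lambda$; $\Omega_i\subsetneq\Omega_{i+1}$ for all $i\ge 0$ and $\bigcup_i\Omega_i=\Gamma$; each $\Omega_i$ is $\Lambda$-admissible and $w_\Lambda(\Omega_{i+1})\cap\Gamma\subset\Omega_i$ for all $i\ge 0$; $\Omega_{n_0}=\Omega'$ for some index $n_0$; and for $i\ge n_0$, $\Omega_i$ is $\Lambda'$-admissible and $w_{\Lambda'}(\Omega_{i+1})\cap\Gamma\subset\Omega_i$. (For $n\ge n_0$ one has $\operatorname{Supp}\varphi\subset\bigcup_{\omega\in\Omega_n}(Q+\omega)$.) $m_n=\#\Omega_n$. $T_n=[c_{Ai-j}]_{i,j\in\Omega_n}$ acts on row vectors $v\in\mathbb{C}^{1\times\Omega_n}$ by $v\mapsto vT_n$, and $P_nY=\{y_k\}_{k\in\Omega_n}$. A Jordan basis for $T_n$ is a basis of $\mathbb{C}^{1\times\Omega_n}$ putting this action into Jordan form; to each basis vector $v$ there corresponds a unique pair $(\lambda,k)$ with $\lambda$ an eigenvalue of $T_n$, $k\ge1$, $v\in\operatorname{Ker}(T_n-\lambda I)^k\setminus\operatorname{Ker}(T_n-\lambda I)^{k-1}$. If $\lambda\ne0$, $h_v=Y_v\Phi$ where $Y_v\in\operatorname{Ker}(L-\lambda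 I)^k$ is the unique extension of $v$ (that is, $P_nY_v=v$); such $h_v$ satisfies $(D_A-\lambda I)^kh_v=0$ with $(D_Af)(x)=f(A^{-1}x)$, and these are the functions called homogeneous. If $\lambda=0$, $h_v(x)=\sum_{k\in\Omega_n}v_k\varphi(x+k)$.
   Formalization: The expansion of f(x) is proved for every x lying in only one translate of Q, hence for almost every x; where translates of Q overlap (a null set) the sum counts f(x) several times, so the identity as written fails there. *)

theory Defs
  imports "HOL-Analysis.Analysis"
    "Jordan_Normal_Form.Gauss_Jordan_Elimination"
    "Jordan_Normal_Form.Jordan_Normal_Form"
begin

hide_const (open) Matrix.vec
type_synonym 'd seqs = "real ^ 'd \<Rightarrow> complex"

definition is_lattice :: "(real ^ 'd) set \<Rightarrow> bool" where
  "is_lattice \<Gamma> \<longleftrightarrow>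
     (\<exists>M :: real ^ 'd ^ 'd. invertible M \<and> \<Gamma> = (*v) M ` {z. \<forall>i. vec_nth z i \<in> \<int>})"

text \<open>The eigenvalues of the real matrix \<open>A\<close> are the complex ones.\<close>

definition is_dilation :: "(real ^ 'd) set \<Rightarrow> real ^ 'd ^ 'd \<Rightarrow> bool" where
  "is_dilation \<Gamma> A \<longleftrightarrow>
     (*v) A ` \<Gamma> \<subseteq> \<Gamma> \<and>
     (\<forall>\<mu> :: complex. (\<exists>z. z \<noteq> 0 \<and> map_matrix complex_of_real A *v z = \<mu> *s z) \<longrightarrow> norm \<mu> > 1)"

definition w_map :: "real ^ 'd ^ 'd \<Rightarrow> (real ^ 'd) set \<Rightarrow> (real ^ 'd) set \<Rightarrow> (real ^ 'd) set" where
  "w_map A H B = {matrix_inv A *v (b + h) | b h. b \<in> B \<and> h \<in> H}"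

definition attractor :: "real ^ 'd ^ 'd \<Rightarrow> (real ^ 'd) set \<Rightarrow> (real ^ 'd) set" where
  "attractor A H = (THE K. K \<noteq> {} \<and> compact K \<and> w_map A H K = K)"

definition admissible ::
  "(real ^ 'd) set \<Rightarrow> real ^ 'd ^ 'd \<Rightarrow> (real ^ 'd) set \<Rightarrow> (real ^ 'd) set \<Rightarrow> bool" where
  "admissible \<Gamma> A H W \<longleftrightarrow> W \<subseteq> \<Gamma> \<and> w_map A H W \<inter> \<Gamma> \<subseteq> W"

definition full_representatives ::
  "(real ^ 'd) set \<Rightarrow> real ^ 'd ^ 'd \<Rightarrow> (real ^ 'd) set \<Rightarrow> bool" where
  "full_representatives \<Gamma> A D \<longleftrightarrow>
     D \<subseteq> \<Gamma> \<and> (\<forall>\<gamma>\<in>\<Gamma>. \<exists>!d. d \<in> D \<and> \<gamma> - d \<in> (*v) A ` \<Gamma>)"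

definition tile_overlap :: "(real ^ 'd) set \<Rightarrow> (real ^ 'd) set \<Rightarrow> (real ^ 'd) set" where
  "tile_overlap \<Gamma> Q =
     {x. \<exists>k\<in>\<Gamma>. \<exists>l\<in>\<Gamma>. k \<noteq> l \<and> x \<in> (+) k ` Q \<and> x \<in> (+) l ` Q}"

definition is_tile :: "(real ^ 'd) set \<Rightarrow> (real ^ 'd) set \<Rightarrow> bool" where
  "is_tile \<Gamma> Q \<longleftrightarrow> (\<Union>k\<in>\<Gamma>. (+) k ` Q) = UNIV \<and> tile_overlap \<Gamma> Q \<in> null_sets lebesgue"

text \<open>Row vectors indexed by \<open>I \<subseteq> \<Gamma>\<close> are functions vanishing off \<open>I\<close>: \<open>I = \<Gamma>\<close> gives
  the space of all sequences on \<open>\<Gamma>\<close>, and a finite \<open>I\<close> the space of complex row vectors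
  indexed by \<open>I\<close>.\<close>

definition row_vectors :: "(real ^ 'd) set \<Rightarrow> 'd seqs set" where
  "row_vectors I = {y. \<forall>j. j \<notin> I \<longrightarrow> y j = 0}"

text \<open>This is \<open>Y\<Phi>\<close>. For compactly supported \<open>\<phi>\<close> only finitely many summands are nonzero
  at each point.\<close>

definition shift_comb :: "(real ^ 'd) set \<Rightarrow> 'd seqs \<Rightarrow> (real ^ 'd \<Rightarrow> complex) \<Rightarrow> real ^ 'd \<Rightarrow> complex" where
  "shift_comb \<Gamma> Y \<phi> x = (\<Sum>\<^sub>\<infinity>k\<in>\<Gamma>. Y k * \<phi> (x + k))"

definition shift_space :: "(real ^ 'd) set \<Rightarrow> (real ^ 'd \<Rightarrow> complex) \<Rightarrow> (real ^ 'd \<Rightarrow> complex) set" where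
  "shift_space \<Gamma> \<phi> = {shift_comb \<Gamma> Y \<phi> | Y. Y \<in> row_vectors \<Gamma>}"

text \<open>The action \<open>y \<mapsto> y [c\<^bsub>Ai-j\<^esub>]\<^bsub>i,j\<in>I\<^esub>\<close> on row vectors, which is \<open>L\<close> for \<open>I = \<Gamma>\<close> and
  \<open>T\<^sub>n\<close> for \<open>I = \<Omega>\<^sub>n\<close>. If \<open>c\<close> has finite support, the sum has finitely many nonzero terms.\<close>

definition row_op :: "real ^ 'd ^ 'd \<Rightarrow> 'd seqs \<Rightarrow> (real ^ 'd) set \<Rightarrow> 'd seqs \<Rightarrow> 'd seqs" where
  "row_op A c I y = (\<lambda>j. if j \<in> I then \<Sum>\<^sub>\<infinity>i\<in>I. y i * c (A *v i - j) else 0)"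

definition ker_pow ::
  "real ^ 'd ^ 'd \<Rightarrow> 'd seqs \<Rightarrow> (real ^ 'd) set \<Rightarrow> complex \<Rightarrow> nat \<Rightarrow> 'd seqs set" where
  "ker_pow A c I \<mu> k =
     {y \<in> row_vectors I. ((\<lambda>u j. row_op A c I u j - \<mu> * u j) ^^ k) y = (\<lambda>_. 0)}"

definition row_basis :: "(real ^ 'd) set \<Rightarrow> nat \<Rightarrow> (nat \<Rightarrow> 'd seqs) \<Rightarrow> bool" where
  "row_basis I m v \<longleftrightarrow>
     (\<forall>r<m. v r \<in> row_vectors I) \<and>
     (\<forall>u\<in>row_vectors I. \<exists>!a. (\<forall>r\<ge>m. a r = 0) \<and> u = (\<lambda>j. \<Sum>r<m. a r * v r j))"

text \<open>The basis vectors, listed in a suitable order \<open>p\<close>, put the action into Jordan form.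
  Since \<open>p\<close> is arbitrary, the order in which \<open>v\<close> lists the basis does not matter, nor does it
  matter whether the ones of a Jordan block are put above or below the diagonal.\<close>

definition jordan_basis ::
  "real ^ 'd ^ 'd \<Rightarrow> 'd seqs \<Rightarrow> (real ^ 'd) set \<Rightarrow> nat \<Rightarrow> (nat \<Rightarrow> 'd seqs) \<Rightarrow> bool" where
  "jordan_basis A c I m v \<longleftrightarrow>
     row_basis I m v \<and>
     (\<exists>n_as p. sum_list (map fst n_as) = m \<and> p permutes {..<m} \<and>
        (\<forall>r<m. row_op A c I (v (p r)) =
           (\<lambda>j. \<Sum>s<m. jordan_matrix n_as $$ (r, s) * v (p s) j)))"

definition jordan_pair ::
  "real ^ 'd ^ 'd \<Rightarrow> 'd seqs \<Rightarrow> (real ^ 'd) set \<Rightarrow> 'd seqs \<Rightarrow> complex \<times> nat" where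
  "jordan_pair A c I v = (THE (\<mu>, k).
     (\<exists>u\<in>row_vectors I. u \<noteq> (\<lambda>_. 0) \<and> row_op A c I u = (\<lambda>j. \<mu> * u j)) \<and>
     k \<ge> 1 \<and> v \<in> ker_pow A c I \<mu> k - ker_pow A c I \<mu> (k - 1))"

definition row_extension ::
  "real ^ 'd ^ 'd \<Rightarrow> 'd seqs \<Rightarrow> (real ^ 'd) set \<Rightarrow> (real ^ 'd) set \<Rightarrow> complex \<Rightarrow> nat \<Rightarrow> 'd seqs \<Rightarrow> 'd seqs"
  where
  "row_extension A c \<Gamma> I \<mu> k v = (THE Y. Y \<in> ker_pow A c \<Gamma> \<mu> k \<and> (\<forall>j\<in>I. Y j = v j))"

definition jordan_fun ::
  "real ^ 'd ^ 'd \<Rightarrow> 'd seqs \<Rightarrow> (real ^ 'd) set \<Rightarrow> (real ^ 'd \<Rightarrow> complex) \<Rightarrow> (real ^ 'd) set \<Rightarrow>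
     'd seqs \<Rightarrow> real ^ 'd \<Rightarrow> complex" where
  "jordan_fun A c \<Gamma> \<phi> I v x =
     (let (\<mu>, k) = jordan_pair A c I v in
      if \<mu> \<noteq> 0 then shift_comb \<Gamma> (row_extension A c \<Gamma> I \<mu> k v) \<phi> x
      else \<Sum>i\<in>I. v i * \<phi> (x + i))"

text \<open>Below, \<open>e\<close> enumerates the finite index set as \<open>e 0, \<dots>, e (m - 1)\<close>.\<close>

definition basis_matrix :: "nat \<Rightarrow> (nat \<Rightarrow> real ^ 'd) \<Rightarrow> (nat \<Rightarrow> 'd seqs) \<Rightarrow> complex mat" where
  "basis_matrix m e v = mat m m (\<lambda>(r, s). v r (e s))"

definition h_vec ::
  "real ^ 'd ^ 'd \<Rightarrow> 'd seqs \<Rightarrow> (real ^ 'd) set \<Rightarrow> (real ^ 'd \<Rightarrow> complex) \<Rightarrow> (real ^ 'd) set \<Rightarrow>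
     (real ^ 'd) set \<Rightarrow> nat \<Rightarrow> (nat \<Rightarrow> 'd seqs) \<Rightarrow> real ^ 'd \<Rightarrow> complex Matrix.vec" where
  "h_vec A c \<Gamma> \<phi> Q I m v x =
     Matrix.vec m (\<lambda>r. jordan_fun A c \<Gamma> \<phi> I (v r) x * indicator Q x)"

definition alpha_vec :: "nat \<Rightarrow> (nat \<Rightarrow> real ^ 'd) \<Rightarrow> 'd seqs \<Rightarrow> real ^ 'd \<Rightarrow> complex Matrix.vec" where
  "alpha_vec m e \<alpha> \<gamma> = Matrix.vec m (\<lambda>s. \<alpha> (e s + \<gamma>))"

text \<open>The row vector \<open>\<alpha>\<^sub>\<gamma> B\<^sup>-\<^sup>1\<close>: its \<open>s\<close>-th entry pairs \<open>\<alpha>\<^sub>\<gamma>\<close> with the \<open>s\<close>-th column.\<close>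

definition beta_vec ::
  "nat \<Rightarrow> (nat \<Rightarrow> real ^ 'd) \<Rightarrow> (nat \<Rightarrow> 'd seqs) \<Rightarrow> 'd seqs \<Rightarrow> real ^ 'd \<Rightarrow> complex Matrix.vec" where
  "beta_vec m e v \<alpha> \<gamma> =
     Matrix.vec m (\<lambda>s. scalar_prod (alpha_vec m e \<alpha> \<gamma>)
                         (col (the (mat_inverse (basis_matrix m e v))) s))"

end

theory Submission
  imports Defs "HOL-Computational_Algebra.Fundamental_Theorem_Algebra"
begin

text \<open>
  Let \<open>y\<close> be a point of the tile \<open>Q\<close>. If \<open>\<phi>(y + k) \<noteq> 0\<close> for some \<open>k \<in> \<Gamma>\<close>, then
  \<open>k = (y + k) - y\<close> is a difference of a point of the support of \<open>\<phi>\<close> and a point of \<open>Q\<close>. The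
  set of these differences is bounded and covered by its image under \<open>w\<^sub>H\<close> for \<open>H = \<Lambda>'\<close>, so it lies in
  the attractor of \<open>\<Lambda>'\<close> (\<open>difference_with_tile_in_attractor\<close>), and
  \<open>k \<in> \<Omega>' \<subseteq> \<Omega>\<^sub>n\<close>. Hence on \<open>Q\<close> the function \<open>Y\<Phi>\<close> depends only on the entries of \<open>Y\<close> in
  \<open>\<Omega>\<^sub>n\<close>, and \<open>h\<^sub>v(y) = \<Sum>i\<in>\<Omega>\<^sub>n. v\<^sub>i \<phi>(y + i)\<close> for every basis vector \<open>v\<close>: for the
  eigenvalue \<open>0\<close> this is the definition, and otherwise \<open>h\<^sub>v\<close> comes from a sequence extending \<open>v\<close>.
  So \<open>h(y) = B\<^sub>n u\<close> for the column vector \<open>u\<close> of the values \<open>\<phi>(y + i)\<close> with \<open>i \<in> \<Omega>\<^sub>n\<close>, and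
  \<open>\<beta>\<^sub>\<gamma> h(y) = \<Sum>i\<in>\<Omega>\<^sub>n. \<alpha>(i + \<gamma>) \<phi>(y + i)\<close>. For \<open>x\<close> outside the
  overlaps there is exactly one \<open>\<gamma>\<close> with \<open>y = x + \<gamma> \<in> Q\<close>. Only this \<open>\<gamma>\<close> contributes to the
  series, and its term is \<open>f(x)\<close>.

  The objects that enter through definite descriptions have to be shown to exist. For attractors
  this rests on the powers of \<open>A\<^sup>-\<^sup>1\<close> tending to zero, which follows from the eigenvalue condition
  by way of annihilating polynomials (\<open>eigenvalues_imp_orbit_tendsto_0\<close>); the attractor is then the
  largest bounded set that is covered by its image (\<open>attractor_eq_Union_self_covering\<close>). For the
  extension of a basis vector the point is that, beyond \<open>\<Omega>\<^sub>n\<close>, the operator \<open>L\<close> computes each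
  level of the filtration from the previous one, so that \<open>L - \<mu>\<close> can be inverted level by level
  when \<open>\<mu> \<noteq> 0\<close> (\<open>unique_extension\<close>). Finally, each vector of a Jordan basis determines its
  eigenvalue and exponent (\<open>jordan_pair_in_ker_pow\<close>).
\<close>

section \<open>Powers of the inverse of a dilation\<close>

text \<open>Both parts exclude a real eigenvalue in \<open>[-1,1]\<close>. The second one gives each map
  \<open>x \<mapsto> A\<^sup>-\<^sup>1 (x + h)\<close> a fixed point, which is what makes attractors nonempty.\<close>

lemma dilation_invertible:
  fixes A :: "real ^ 'd ^ 'd"
  assumes "is_dilation \<Gamma> A"
  shows "invertible A" and "A *v x = x \<Longrightarrow> x = 0"
proof -
  let ?cx = "\<lambda>x :: real ^ 'd. (\<chi> i. complex_of_real (vec_nth x i)) :: complex ^ 'd"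
  have cx: "map_matrix complex_of_real A *v ?cx x = ?cx (A *v x)" for x
    by (simp add: vec_eq_iff matrix_vector_mult_def map_matrix_def)
  have ev: "norm \<mu> > 1" if "z \<noteq> 0" "map_matrix complex_of_real A *v z = \<mu> *s z" for \<mu> z
    using assms that unfolding is_dilation_def by blast
  have cx0: "?cx x = 0 \<longleftrightarrow> x = 0" for x by (simp add: Finite_Cartesian_Product.vec_eq_iff)
  have *: "x = 0" if "A *v x = r *s x" "\<bar>r\<bar> \<le> 1" for x r
  proof (rule ccontr)
    assume "x \<noteq> 0"
    moreover have "map_matrix complex_of_real A *v ?cx x = complex_of_real r *s ?cx x"
      unfolding cx that(1) by (simp add: Finite_Cartesian_Product.vec_eq_iff)
    ultimately show False using ev[of "?cx x" "complex_of_real r"] cx0 that(2) by simp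
  qed
  show "A *v x = x \<Longrightarrow> x = 0" using *[of x 1] by simp
  have "A *v x = 0 \<Longrightarrow> x = 0" for x using *[of x 0] by simp
  then show "invertible A"
    by (metis invertible_left_inverse matrix_left_invertible_ker)
qed

text \<open>A geometric recursion with a perturbation that tends to zero: this is the step from
  the orbit of \<open>Bz - lz\<close> to the orbit of \<open>z\<close>.\<close>

lemma recurrence_tendsto_0:
  fixes a b :: "nat \<Rightarrow> complex"
  assumes rec: "\<And>n. a (Suc n) = l * a n + b n" and l: "norm l < 1" and b: "b \<longlonglongrightarrow> 0"
  shows "a \<longlonglongrightarrow> 0"
proof (rule LIMSEQ_I)
  fix r :: real assume r: "r > 0"
  define \<delta> where "\<delta> = r / 2 * (1 - norm l)"
  have "\<delta> > 0" using r l by (simp add: \<delta>_def)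
  then obtain N where N: "\<And>n. n \<ge> N \<Longrightarrow> norm (b n) < \<delta>" using LIMSEQ_D[OF b, of \<delta>] by auto
  have bound: "norm (a (N + k)) \<le> norm l ^ k * norm (a N) + r / 2" for k
  proof (induction k)
    case 0 then show ?case using r by simp
  next
    case (Suc k)
    have "norm (a (N + Suc k)) \<le> norm l * norm (a (N + k)) + norm (b (N + k))"
      using norm_triangle_ineq[of "l * a (N + k)" "b (N + k)"] rec[of "N + k"] by (simp add: norm_mult)
    also have "\<dots> \<le> norm l * (norm l ^ k * norm (a N) + r / 2) + \<delta>"
      using Suc.IH N[of "N + k"] by (intro add_mono mult_left_mono) auto
    also have "\<dots> = norm l ^ Suc k * norm (a N) + r / 2" by (simp add: \<delta>_def field_simps)
    finally show ?case .
  qed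
  have "(\<lambda>k. norm l ^ k * norm (a N)) \<longlonglongrightarrow> 0"
    using l by (intro tendsto_mult_left_zero LIMSEQ_realpow_zero) auto
  then obtain M where M: "\<And>k. k \<ge> M \<Longrightarrow> norm l ^ k * norm (a N) < r / 2"
    using LIMSEQ_D[of _ 0 "r / 2"] r by fastforce
  have "norm (a n - 0) < r" if "n \<ge> N + M" for n
  proof -
    have "norm l ^ (n - N) * norm (a N) < r / 2" using that by (intro M) simp
    then show ?thesis using bound[of "n - N"] that by simp
  qed
  then show "\<exists>no. \<forall>n\<ge>no. norm (a n - 0) < r" by blast
qed

text \<open>This is the vector \<open>p(B) z\<close>.\<close>

definition poly_orbit :: "complex poly \<Rightarrow> complex ^ 'd ^ 'd \<Rightarrow> complex ^ 'd \<Rightarrow> complex ^ 'd" where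
  "poly_orbit p B z = (\<Sum>i\<le>degree p. coeff p i *s (((*v) B ^^ i) z))"

lemma poly_orbit_ge:
  "degree p \<le> N \<Longrightarrow> poly_orbit p B z = (\<Sum>i\<le>N. coeff p i *s (((*v) B ^^ i) z))"
  unfolding poly_orbit_def
  by (rule sum.mono_neutral_left) (auto simp: coeff_eq_0)

lemma funpow_linear:
  fixes B :: "complex ^ 'd ^ 'd"
  shows "((*v) B ^^ n) (x - y) = ((*v) B ^^ n) x - ((*v) B ^^ n) y"
    and "((*v) B ^^ n) (l *s x) = l *s ((*v) B ^^ n) x"
  by (induction n) (auto simp: matrix_vector_mult_diff_distrib vector_scalar_commute)

lemma poly_orbit_factor:
  "poly_orbit ([:- l, 1:] * q) B z = poly_orbit q B (B *v z - l *s z)"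
proof -
  let ?N = "Suc (degree q)"
  have deg: "degree ([:- l, 1:] * q) \<le> ?N"
    using degree_mult_le[of "[:- l, 1:]" q] by simp
  have c: "coeff ([:- l, 1:] * q) i = coeff (pCons 0 q) i - l * coeff q i" for i
    by simp
  have "poly_orbit ([:- l, 1:] * q) B z =
      (\<Sum>i\<le>?N. coeff (pCons 0 q) i *s (((*v) B ^^ i) z)) - (\<Sum>i\<le>?N. (l * coeff q i) *s (((*v) B ^^ i) z))"
    unfolding poly_orbit_ge[OF deg] c by (simp only: vector_sub_rdistrib sum_subtractf)
  also have "(\<Sum>i\<le>?N. coeff (pCons 0 q) i *s (((*v) B ^^ i) z)) =
      (\<Sum>i\<le>degree q. coeff q i *s (((*v) B ^^ i) (B *v z)))"
    by (subst sum.atMost_Suc_shift) (simp del: funpow.simps(2) add: funpow_Suc_right)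
  also have "(\<Sum>i\<le>?N. (l * coeff q i) *s (((*v) B ^^ i) z)) =
      (\<Sum>i\<le>degree q. coeff q i *s (((*v) B ^^ i) (l *s z)))"
    by (simp add: coeff_eq_0 funpow_linear vector_smult_assoc mult.commute)
  also have "(\<Sum>i\<le>degree q. coeff q i *s (((*v) B ^^ i) (B *v z))) - \<dots> = poly_orbit q B (B *v z - l *s z)"
    by (simp add: poly_orbit_def funpow_linear sum_subtractf[symmetric] vector_ssub_ldistrib)
  finally show ?thesis .
qed

lemma poly_orbit_commute:
  "poly_orbit q B (B *v z - l *s z) = B *v poly_orbit q B z - l *s poly_orbit q B z"
proof -
  have "(\<Sum>i\<le>degree q. coeff q i *s (((*v) B ^^ i) (B *v z))) = B *v poly_orbit q B z"
    unfolding poly_orbit_def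
    by (simp add: funpow_swap1 vec.linear_sum[OF matrix_vector_mul_linear_gen] vector_scalar_commute)
  moreover have "(\<Sum>i\<le>degree q. coeff q i *s (((*v) B ^^ i) (l *s z))) = l *s poly_orbit q B z"
    unfolding poly_orbit_def
    by (simp add: funpow_linear vec.scale_sum_right mult.commute)
  moreover have "poly_orbit q B (B *v z - l *s z) =
      (\<Sum>i\<le>degree q. coeff q i *s (((*v) B ^^ i) (B *v z))) - (\<Sum>i\<le>degree q. coeff q i *s (((*v) B ^^ i) (l *s z)))"
    by (simp only: poly_orbit_def funpow_linear(1) sum_subtractf vector_ssub_ldistrib)
  ultimately show ?thesis by simp
qed

text \<open>The vectors \<open>z, Bz, \<dots>, B\<^sup>d z\<close> are \<open>d + 1\<close> many in dimension \<open>d\<close>, so either two of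
  them coincide or they are linearly dependent.\<close>

lemma annihilating_polynomial:
  fixes B :: "complex ^ 'd ^ 'd"
  shows "\<exists>p. p \<noteq> 0 \<and> poly_orbit p B z = 0"
proof (cases "inj_on (\<lambda>i. ((*v) B ^^ i) z) {..CARD('d)}")
  case False
  then obtain i j where ij: "i \<noteq> j" "((*v) B ^^ i) z = ((*v) B ^^ j) z"
    by (auto simp: inj_on_def)
  let ?p = "monom 1 i - monom 1 j :: complex poly"
  have "coeff ?p i \<noteq> 0" using ij by simp
  then have "?p \<noteq> 0" by (metis coeff_0)
  moreover have "poly_orbit ?p B z = 0"
  proof -
    have "degree ?p \<le> i + j" by (rule degree_le) simp
    then have "poly_orbit ?p B z = (\<Sum>k\<le>i+j. coeff ?p k *s (((*v) B ^^ k) z))" by (rule poly_orbit_ge)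
    also have "\<dots> = (\<Sum>k\<in>{i,j}. coeff ?p k *s (((*v) B ^^ k) z))"
      by (rule sum.mono_neutral_right) auto
    also have "\<dots> = 0" using ij by simp
    finally show ?thesis .
  qed
  ultimately show ?thesis by blast
next
  case True
  let ?S = "(\<lambda>i. ((*v) B ^^ i) z) ` {..CARD('d)}"
  have "card ?S = Suc (CARD('d))" using True by (simp add: card_image)
  then have "vec.dependent ?S"
    using vec.dim_eq_card_independent[of ?S] vec.dim_subset_UNIV[of ?S]
    by (auto simp: vec.dimension_def card_cart_basis)
  then obtain u where u: "\<exists>v\<in>?S. u v \<noteq> 0" "(\<Sum>v\<in>?S. u v *s v) = 0"
    using vec.dependent_finite[of ?S] by auto
  define p where "p = (\<Sum>i\<le>CARD('d). monom (u (((*v) B ^^ i) z)) i)"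
  have co: "coeff p i = (if i \<le> CARD('d) then u (((*v) B ^^ i) z) else 0)" for i
    by (simp add: p_def coeff_sum)
  have p0: "p \<noteq> 0" using u(1) co by (metis (no_types, lifting) atMost_iff coeff_0 imageE)
  have "degree p \<le> CARD('d)" by (rule degree_le) (simp add: co)
  then have "poly_orbit p B z = (\<Sum>i\<le>CARD('d). u (((*v) B ^^ i) z) *s (((*v) B ^^ i) z))"
    by (subst poly_orbit_ge) (auto simp: co)
  also have "\<dots> = 0" using u(2) by (simp add: sum.reindex[OF True])
  finally show ?thesis using p0 by blast
qed

text \<open>Induction on the degree of a polynomial \<open>p = (X - l) q\<close> with \<open>p(B) z = 0\<close>. The vector
  \<open>q(B) z\<close> is killed by \<open>B - l\<close>. If it is zero, then \<open>q\<close> has smaller degree and annihilates \<open>z\<close>.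
  Otherwise \<open>l\<close> is an eigenvalue, hence of modulus less than one, and since \<open>q\<close> annihilates
  \<open>Bz - lz\<close>, the orbit of \<open>z\<close> is a geometric recursion with a perturbation that tends to zero.\<close>

lemma eigenvalues_imp_orbit_tendsto_0:
  fixes B :: "complex ^ 'd ^ 'd"
  assumes ev: "\<And>l z. z \<noteq> 0 \<Longrightarrow> B *v z = l *s z \<Longrightarrow> norm l < 1"
  shows "(\<lambda>n. vec_nth (((*v) B ^^ n) z) i) \<longlonglongrightarrow> 0"
proof -
  have "(\<lambda>n. vec_nth (((*v) B ^^ n) z) i) \<longlonglongrightarrow> 0" if "p \<noteq> 0" "poly_orbit p B z = 0" for p
    using that
  proof (induction "degree p" arbitrary: p z)
    case 0
    then obtain a where "p = [:a:]" by (metis degree_0_id)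
    then have "z = 0" using 0 by (simp add: poly_orbit_def)
    moreover have "((*v) B ^^ n) 0 = 0" for n by (induction n) auto
    ultimately show ?case by simp
  next
    case (Suc d)
    have "\<not> constant (poly p)" using Suc.hyps(2) by (simp add: constant_degree)
    then obtain l where "poly p l = 0" using fundamental_theorem_of_algebra by blast
    then obtain q where p: "p = [:- l, 1:] * q" by (metis poly_eq_0_iff_dvd dvdE)
    with Suc.prems have q: "q \<noteq> 0" by auto
    have "degree p = degree [:- l, 1:] + degree q" unfolding p using q by (intro degree_mult_eq) auto
    then have dq: "d = degree q" using Suc.hyps(2) by simp
    have w0: "poly_orbit q B (B *v z - l *s z) = 0"
      using Suc.prems(2) unfolding p poly_orbit_factor .
    show ?case
    proof (cases "poly_orbit q B z = 0")
      case True
      then show ?thesis using Suc.hyps(1)[OF dq q] by blast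
    next
      case False
      have "B *v poly_orbit q B z = l *s poly_orbit q B z"
        using w0 by (simp add: poly_orbit_commute)
      then have l: "norm l < 1" using ev False by blast
      have "(\<lambda>n. vec_nth (((*v) B ^^ n) (B *v z - l *s z)) i) \<longlonglongrightarrow> 0"
        using Suc.hyps(1)[OF dq q w0] .
      then show ?thesis
        by (rule recurrence_tendsto_0[rotated 2, OF _ _ l]) (simp add: funpow_linear funpow_swap1)
    qed
  qed
  then show ?thesis using annihilating_polynomial by blast
qed

lemma matrix_inv_cancel:
  fixes M :: "real ^ 'd ^ 'd"
  assumes "invertible M"
  shows "M ** matrix_inv M = Finite_Cartesian_Product.mat 1"
    and "matrix_inv M ** M = Finite_Cartesian_Product.mat 1"
proof -
  have "M ** matrix_inv M = Finite_Cartesian_Product.mat 1 \<and> matrix_inv M ** M = Finite_Cartesian_Product.mat 1"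
    unfolding matrix_inv_def by (rule someI_ex) (use assms invertible_def in blast)
  then show "M ** matrix_inv M = Finite_Cartesian_Product.mat 1"
    and "matrix_inv M ** M = Finite_Cartesian_Product.mat 1" by blast+
qed

text \<open>The inverse has the reciprocal eigenvalues, so its complex orbits tend to zero. Applied
  to the finitely many vectors of a basis this bounds the powers uniformly. The inverse
  itself need not contract the Euclidean norm, hence a sequence of bounds.\<close>

lemma inverse_dilation_contracts:
  fixes A :: "real ^ 'd ^ 'd"
  assumes dil: "is_dilation \<Gamma> A"
  obtains \<epsilon> :: "nat \<Rightarrow> real" where "\<epsilon> \<longlonglongrightarrow> 0"
    and "\<And>n x. norm (((*v) (matrix_inv A) ^^ n) x) \<le> \<epsilon> n * norm x"
proof -
  let ?B = "matrix_inv A"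
  let ?CA = "map_matrix complex_of_real A" and ?CB = "map_matrix complex_of_real ?B"
  let ?cx = "\<lambda>x :: real ^ 'd. (\<chi> i. complex_of_real (vec_nth x i)) :: complex ^ 'd"
  have inv: "invertible A" using dilation_invertible(1)[OF dil] .
  have "?CA ** ?CB = map_matrix complex_of_real (A ** ?B)"
    by (simp add: Finite_Cartesian_Product.vec_eq_iff matrix_matrix_mult_def map_matrix_def)
  also have "\<dots> = Finite_Cartesian_Product.mat 1"
    using matrix_inv_cancel(1)[OF inv] by (simp add: Finite_Cartesian_Product.vec_eq_iff Finite_Cartesian_Product.mat_def map_matrix_def)
  finally have CAB: "?CA *v (?CB *v z) = z" for z by (simp add: matrix_vector_mul_assoc)
  have ev: "norm l < 1" if z: "z \<noteq> 0" "?CB *v z = l *s z" for l z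
  proof -
    have lz: "l *s (?CA *v z) = z" using CAB[of z] z(2) by (simp add: vector_scalar_commute)
    then have l0: "l \<noteq> 0" using z(1) by auto
    have "?CA *v z = inverse l *s (l *s (?CA *v z))" using l0 by (simp add: vector_smult_assoc)
    then have "?CA *v z = inverse l *s z" unfolding lz .
    then have "norm (inverse l) > 1" using dil z(1) unfolding is_dilation_def by blast
    then show ?thesis by (simp add: norm_inverse one_less_inverse_iff)
  qed
  have cx: "(((*v) ?CB) ^^ n) (?cx x) = ?cx ((((*v) ?B) ^^ n) x)" for n x
  proof (induction n)
    case (Suc n)
    then show ?case
      by (simp add: Finite_Cartesian_Product.vec_eq_iff matrix_vector_mult_def map_matrix_def)
  qed simp
  have lim: "(\<lambda>n. (((*v) ?B) ^^ n) x) \<longlonglongrightarrow> 0" for x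
  proof (rule vec_tendstoI)
    fix i
    have "(\<lambda>n. complex_of_real (vec_nth ((((*v) ?B) ^^ n) x) i)) \<longlonglongrightarrow> complex_of_real 0"
      using eigenvalues_imp_orbit_tendsto_0[where B = ?CB and z = "?cx x" and i = i, OF ev] unfolding cx by simp
    then show "(\<lambda>n. vec_nth ((((*v) ?B) ^^ n) x) i) \<longlonglongrightarrow> vec_nth 0 i"
      by (simp only: tendsto_of_real_iff zero_index)
  qed
  define \<epsilon> where "\<epsilon> n = (\<Sum>b\<in>Basis. norm ((((*v) ?B) ^^ n) b))" for n
  have "\<epsilon> \<longlonglongrightarrow> 0"
    unfolding \<epsilon>_def using tendsto_sum[of Basis "\<lambda>b n. norm ((((*v) ?B) ^^ n) b)" "\<lambda>_. 0" sequentially]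
      lim[THEN tendsto_norm] by simp
  moreover have "norm ((((*v) ?B) ^^ n) x) \<le> \<epsilon> n * norm x" for n x
  proof -
    have "linear (((*v) ?B) ^^ n)"
    proof (induction n)
      case (Suc n)
      then show ?case using linear_compose[OF Suc matrix_vector_mul_linear] by (simp add: comp_def)
    qed (simp add: linear_iff)
    then have "(((*v) ?B) ^^ n) (\<Sum>b\<in>Basis. inner x b *\<^sub>R b) =
        (\<Sum>b\<in>Basis. inner x b *\<^sub>R (((*v) ?B) ^^ n) b)"
      by (simp add: linear_sum linear_scale)
    then have "(((*v) ?B) ^^ n) x = (\<Sum>b\<in>Basis. inner x b *\<^sub>R (((*v) ?B) ^^ n) b)"
      by (simp only: euclidean_representation)
    also have "norm \<dots> \<le> (\<Sum>b\<in>Basis. norm x * norm ((((*v) ?B) ^^ n) b))"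
      by (rule sum_norm_le) (auto simp: Basis_le_norm intro!: mult_right_mono)
    finally show ?thesis by (simp add: \<epsilon>_def sum_distrib_left mult.commute)
  qed
  ultimately show ?thesis using that by blast
qed

section \<open>Attractors\<close>

lemma w_map_mono: "S \<subseteq> T \<Longrightarrow> w_map A H S \<subseteq> w_map A H T"
  unfolding w_map_def by blast

text \<open>The digits chosen along the way contribute a summand that does not depend on the
  starting point, so two starting points can be followed along the same digits.\<close>

lemma w_map_iterate:
  "(w_map A H ^^ n) S =
     {((*v) (matrix_inv A) ^^ n) y + t | y t. y \<in> S \<and> t \<in> (w_map A H ^^ n) {0}}"
proof (induction n)
  case (Suc n)
  let ?B = "(*v) (matrix_inv A)"
  let ?T = "(w_map A H ^^ n) {0}"
  have "(w_map A H ^^ Suc n) S = {?B (b + h) | b h. b \<in> (w_map A H ^^ n) S \<and> h \<in> H}"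
    by (simp add: w_map_def)
  also have "\<dots> = {?B ((?B ^^ n) y + t + h) | y t h. y \<in> S \<and> t \<in> ?T \<and> h \<in> H}"
    unfolding Suc by blast
  also have "\<dots> = {(?B ^^ Suc n) y + ?B (t + h) | y t h. y \<in> S \<and> t \<in> ?T \<and> h \<in> H}"
    by (simp add: matrix_vector_right_distrib add.assoc)
  also have "\<dots> = {(?B ^^ Suc n) y + t | y t. y \<in> S \<and> t \<in> w_map A H ?T}"
    unfolding w_map_def by blast
  finally show ?case by simp
qed auto

lemma w_map_image: "w_map A H S = (\<lambda>(b, h). matrix_inv A *v (b + h)) ` (S \<times> H)"
  unfolding w_map_def by auto

lemma compact_w_map:
  assumes "compact S" "finite H"
  shows "compact (w_map A H S)"
proof -
  have "continuous_on (S \<times> H) (\<lambda>p. matrix_inv A *v (fst p + snd p))"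
    by (rule linear_continuous_on_compose[OF _ matrix_vector_mul_linear]) (intro continuous_intros)
  then show ?thesis
    unfolding w_map_image using compact_Times[OF assms(1) finite_imp_compact[OF assms(2)]]
    by (intro compact_continuous_image) (simp_all add: case_prod_beta)
qed

lemma bounded_w_map:
  assumes "bounded S" "finite H"
  shows "bounded (w_map A H S)"
proof -
  have "compact (w_map A H (closure S))" using assms by (intro compact_w_map) (simp_all add: compact_closure)
  then show ?thesis
    using compact_imp_bounded bounded_subset w_map_mono[OF closure_subset] by metis
qed

lemma iterate_covers: "S \<subseteq> w_map A H S \<Longrightarrow> S \<subseteq> (w_map A H ^^ n) S"
proof (induction n)
  case (Suc n)
  then show ?case using w_map_mono[of S "(w_map A H ^^ n) S" A H] by auto
qed simp

lemma iterate_inside: "w_map A H S \<subseteq> S \<Longrightarrow> (w_map A H ^^ n) S \<subseteq> S"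
proof (induction n)
  case (Suc n)
  then show ?case using w_map_mono[of "(w_map A H ^^ n) S" S A H] by auto
qed simp

text \<open>For a power that halves norms, a point of \<open>S\<close> is bounded by half the supremum of \<open>S\<close>
  plus a constant coming from the digits alone; hence the supremum is at most twice that constant.\<close>

lemma self_covering_uniform_bound:
  assumes dil: "is_dilation \<Gamma> A" and H: "finite H"
  obtains R where "\<And>S x. bounded S \<Longrightarrow> S \<subseteq> w_map A H S \<Longrightarrow> x \<in> S \<Longrightarrow> norm x \<le> R"
proof -
  obtain \<epsilon> where \<epsilon>: "\<epsilon> \<longlonglongrightarrow> 0" "\<And>n x. norm (((*v) (matrix_inv A) ^^ n) x) \<le> \<epsilon> n * norm x"
    using inverse_dilation_contracts[OF dil] by metis
  obtain N where N: "\<epsilon> N < 1/2"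
    using order_tendstoD(2)[OF \<epsilon>(1), of "1/2"] unfolding eventually_sequentially by auto
  have "bounded ((w_map A H ^^ N) {0})" by (induction N) (auto simp: bounded_w_map H)
  then obtain C where C: "\<And>t. t \<in> (w_map A H ^^ N) {0} \<Longrightarrow> norm t \<le> C"
    unfolding bounded_iff by auto
  have "norm x \<le> 2 * C" if S: "bounded S" "S \<subseteq> w_map A H S" "x \<in> S" for S x
  proof -
    have bdd: "bdd_above (norm ` S)" using S(1) unfolding bounded_iff by (auto intro: bdd_aboveI2)
    let ?M = "SUP y\<in>S. norm y"
    have "norm z \<le> ?M / 2 + C" if z: "z \<in> S" for z
    proof -
      obtain y t where yt: "z = ((*v) (matrix_inv A) ^^ N) y + t" "y \<in> S" "t \<in> (w_map A H ^^ N) {0}"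
        using iterate_covers[OF S(2), of N] z unfolding w_map_iterate[where S = S and n = N] by blast
      have "norm z \<le> \<epsilon> N * norm y + C"
        unfolding yt(1) using \<epsilon>(2)[of N y] C[OF yt(3)] by (intro norm_triangle_le add_mono)
      also have "\<epsilon> N * norm y \<le> 1/2 * norm y" using N by (intro mult_right_mono) auto
      also have "norm y \<le> ?M" using yt(2) bdd by (rule cSUP_upper)
      finally show ?thesis by simp
    qed
    then have "?M \<le> ?M / 2 + C" using S(3) by (intro cSUP_least) auto
    moreover have "norm x \<le> ?M" using S(3) bdd by (rule cSUP_upper)
    ultimately show ?thesis by simp
  qed
  then show ?thesis using that by blast
qed

text \<open>A point of \<open>S\<close> has preimages in \<open>S\<close> of every order. Replacing the preimage of order \<open>n\<close>
  by a point of \<open>K\<close> and following the same digits leads to a point of \<open>K\<close> whose distance to the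
  given one tends to zero with \<open>n\<close>.\<close>

lemma self_covering_subset_attracted:
  assumes dil: "is_dilation \<Gamma> A"
    and S: "bounded S" "S \<subseteq> w_map A H S"
    and K: "closed K" "K \<noteq> {}" "w_map A H K \<subseteq> K"
  shows "S \<subseteq> K"
proof
  fix x assume x: "x \<in> S"
  obtain \<epsilon> where \<epsilon>: "\<epsilon> \<longlonglongrightarrow> 0" "\<And>n x. norm (((*v) (matrix_inv A) ^^ n) x) \<le> \<epsilon> n * norm x"
    using inverse_dilation_contracts[OF dil] by metis
  obtain z where z: "z \<in> K" using K(2) by blast
  obtain R where R: "\<And>y. y \<in> S \<Longrightarrow> norm y \<le> R" using S(1) unfolding bounded_iff by blast
  have "\<exists>x'\<in>K. norm (x' - x) \<le> \<bar>\<epsilon> n\<bar> * (norm z + R)" for n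
  proof -
    obtain y t where yt: "x = ((*v) (matrix_inv A) ^^ n) y + t" "y \<in> S" "t \<in> (w_map A H ^^ n) {0}"
      using iterate_covers[OF S(2), of n] x unfolding w_map_iterate[where S = S and n = n] by blast
    let ?x' = "((*v) (matrix_inv A) ^^ n) z + t"
    have "?x' \<in> (w_map A H ^^ n) K" using z yt(3) unfolding w_map_iterate[where S = K and n = n] by blast
    then have "?x' \<in> K" using iterate_inside[OF K(3)] by blast
    moreover have "norm (?x' - x) \<le> norm (((*v) (matrix_inv A) ^^ n) z) + norm (((*v) (matrix_inv A) ^^ n) y)"
      unfolding yt(1) by (simp add: norm_triangle_ineq4)
    then have "norm (?x' - x) \<le> \<epsilon> n * norm z + \<epsilon> n * norm y"
      using \<epsilon>(2)[of n z] \<epsilon>(2)[of n y] by linarith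
    moreover have "\<epsilon> n * (norm z + norm y) \<le> \<bar>\<epsilon> n\<bar> * (norm z + R)"
      using R[OF yt(2)] by (intro mult_mono) auto
    ultimately show ?thesis by (auto simp: distrib_left intro!: bexI[of _ ?x'])
  qed
  then obtain g where g: "\<And>n. g n \<in> K" "\<And>n. norm (g n - x) \<le> \<bar>\<epsilon> n\<bar> * (norm z + R)" by metis
  have "(\<lambda>n. \<bar>\<epsilon> n\<bar> * (norm z + R)) \<longlonglongrightarrow> 0"
    using tendsto_mult_left_zero[OF tendsto_rabs_zero[OF \<epsilon>(1)]] .
  then have "(\<lambda>n. g n - x) \<longlonglongrightarrow> 0" by (rule Lim_null_comparison[rotated]) (use g(2) in auto)
  then have "g \<longlonglongrightarrow> x" by (simp add: LIM_zero_iff)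
  then show "x \<in> K" using closed_sequentially[OF K(1)] g(1) by blast
qed

text \<open>The union \<open>K\<close> of all bounded sets \<open>S \<subseteq> w\<^sub>H(S)\<close> is the greatest of them, because such
  sets are uniformly bounded. Maximality alone then makes \<open>K\<close> invariant and closed, without any
  convergence of sets: both \<open>w\<^sub>H(K)\<close> and the closure of \<open>K\<close> are again bounded and covered by their
  images. This description also turns membership in an attractor into the exhibition of a
  bounded set that covers itself.\<close>

proposition attractor_eq_Union_self_covering:
  assumes dil: "is_dilation \<Gamma> A" and H: "finite H" "H \<noteq> {}"
  defines "K \<equiv> \<Union>{S. bounded S \<and> S \<subseteq> w_map A H S}"
  shows "attractor A H = K" "bounded K" "w_map A H K = K"
proof -
  obtain R where R: "\<And>S x. bounded S \<Longrightarrow> S \<subseteq> w_map A H S \<Longrightarrow> x \<in> S \<Longrightarrow> norm x \<le> R"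
    using self_covering_uniform_bound[OF dil H(1)] by blast
  have K: "x \<in> K \<longleftrightarrow> (\<exists>S. bounded S \<and> S \<subseteq> w_map A H S \<and> x \<in> S)" for x unfolding K_def by auto
  have "norm x \<le> R" if "x \<in> K" for x using that R unfolding K by metis
  then have bK: "bounded K" unfolding bounded_iff by blast
  have max: "S \<subseteq> K" if "bounded S" "S \<subseteq> w_map A H S" for S using that K by (metis subsetI)
  have "S \<subseteq> w_map A H K" if "bounded S" "S \<subseteq> w_map A H S" for S
    using w_map_mono[OF max[OF that]] that(2) by (rule order.trans[rotated])
  then have "K \<subseteq> w_map A H K" using K by (metis subsetD subsetI)
  moreover have "w_map A H K \<subseteq> K"
    using bounded_w_map[OF bK H(1)] w_map_mono[OF calculation] by (intro max) auto
  ultimately have fix_K: "w_map A H K = K" by blast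
  \<comment> \<open>The image of the closure is compact and contains \<open>w\<^sub>H(K) = K\<close>, so the closure covers itself.\<close>
  have "compact (w_map A H (closure K))"
    using bK H(1) by (intro compact_w_map) (simp_all add: compact_closure)
  then have "closure K \<subseteq> w_map A H (closure K)"
    using w_map_mono[OF closure_subset, of A H K] unfolding fix_K
    by (intro closure_minimal compact_imp_closed)
  then have "closure K \<subseteq> K" using bK by (intro max) (auto simp: bounded_closure)
  then have "closed K" by (metis closure_subset closed_closure subset_antisym)
  with bK have cK: "compact K" by (simp add: compact_eq_bounded_closed)
  have inv: "invertible A" and no_fix: "\<And>x. A *v x = x \<Longrightarrow> x = 0" using dilation_invertible[OF dil] by auto
  obtain h where h: "h \<in> H" using H(2) by blast
  have "linear (\<lambda>x. A *v x - x)" by (intro linear_compose_sub) (auto simp: linear_id[unfolded id_def])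
  moreover have "inj (\<lambda>x. A *v x - x)"
    unfolding linear_injective_0[OF calculation] using no_fix by auto
  ultimately have surj: "surj (\<lambda>x. A *v x - x)" by (rule linear_injective_imp_surjective) (rule refl)
  obtain x where "h = A *v x - x" using surjD[OF surj, of h] by blast
  then have "x + h = A *v x" by (simp add: algebra_simps)
  then have "x = matrix_inv A *v (x + h)" by (simp add: matrix_vector_mul_assoc matrix_inv_cancel(2)[OF inv])
  then have "{x} \<subseteq> w_map A H {x}" using h unfolding w_map_def by blast
  then have "K \<noteq> {}" using max[of "{x}"] by auto
  show "attractor A H = K" unfolding attractor_def
  proof (rule the_equality)
    show "K \<noteq> {} \<and> compact K \<and> w_map A H K = K" using \<open>K \<noteq> {}\<close> cK fix_K by blast
    fix K' assume K': "K' \<noteq> {} \<and> compact K' \<and> w_map A H K' = K'"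
    have "K \<subseteq> K'" 
      by (rule self_covering_subset_attracted[OF dil bK]) (use K' fix_K compact_imp_closed in auto)
    moreover have "K' \<subseteq> K" by (rule max) (use K' compact_imp_bounded in auto)
    ultimately show "K' = K" by blast
  qed
  show "bounded K" "w_map A H K = K" by fact+
qed

section \<open>Lattices\<close>

lemma lattice_diff: "is_lattice \<Gamma> \<Longrightarrow> x \<in> \<Gamma> \<Longrightarrow> y \<in> \<Gamma> \<Longrightarrow> x - y \<in> \<Gamma>"
  unfolding is_lattice_def
  by (auto simp: matrix_vector_mult_diff_distrib[symmetric] intro!: imageI)

lemma lattice_zero: "is_lattice \<Gamma> \<Longrightarrow> 0 \<in> \<Gamma>"
  unfolding is_lattice_def by (auto simp: image_iff intro!: exI[of _ 0])

lemma lattice_uminus: "is_lattice \<Gamma> \<Longrightarrow> x \<in> \<Gamma> \<Longrightarrow> - x \<in> \<Gamma>"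
  using lattice_diff[of \<Gamma> 0 x] lattice_zero by auto

lemma lattice_add: "is_lattice \<Gamma> \<Longrightarrow> x \<in> \<Gamma> \<Longrightarrow> y \<in> \<Gamma> \<Longrightarrow> x + y \<in> \<Gamma>"
  using lattice_diff[of \<Gamma> x "- y"] lattice_uminus[of \<Gamma> y] by auto

lemma finite_lattice_Int_bounded:
  fixes \<Gamma> :: "(real ^ 'd) set"
  assumes "is_lattice \<Gamma>" "bounded S"
  shows "finite (\<Gamma> \<inter> S)"
proof -
  obtain M :: "real ^ 'd ^ 'd" where M: "invertible M" "\<Gamma> = (*v) M ` {z. \<forall>i. vec_nth z i \<in> \<int>}"
    using assms(1) unfolding is_lattice_def by blast
  have "bounded ((*v) (matrix_inv M) ` S)" using assms(2) by (intro bounded_linear_image) (auto intro: linear_linear)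
  then obtain R where R: "\<And>x. x \<in> S \<Longrightarrow> norm (matrix_inv M *v x) \<le> R" unfolding bounded_iff by auto
  define F where "F = real_of_int ` {- \<lceil>R\<rceil>..\<lceil>R\<rceil>}"
  have "\<Gamma> \<inter> S \<subseteq> (*v) M ` vec_lambda ` (UNIV \<rightarrow>\<^sub>E F)"
  proof
    fix x assume x: "x \<in> \<Gamma> \<inter> S"
    then obtain z where z: "x = M *v z" "\<forall>i. vec_nth z i \<in> \<int>" using M(2) by auto
    have "matrix_inv M *v x = z" unfolding z(1) by (simp add: matrix_vector_mul_assoc matrix_inv_cancel(2)[OF M(1)])
    then have "norm z \<le> R" using R[of x] x by simp
    then have b: "\<bar>vec_nth z i\<bar> \<le> R" for i using component_le_norm_cart[of z i] by linarith
    have "vec_nth z i \<in> F" for i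
    proof -
      obtain k where k: "vec_nth z i = of_int k" using z(2) by (metis Ints_cases)
      then have "\<bar>k\<bar> \<le> \<lceil>R\<rceil>" using b[of i] by (simp add: le_ceiling_iff)
      then show ?thesis unfolding F_def k by (intro imageI) auto
    qed
    then have "z \<in> vec_lambda ` (UNIV \<rightarrow>\<^sub>E F)"
      by (intro image_eqI[of _ _ "vec_nth z"]) (auto simp: vec_nth_inverse)
    then show "x \<in> (*v) M ` vec_lambda ` (UNIV \<rightarrow>\<^sub>E F)" using z(1) by blast
  qed
  moreover have "finite (UNIV \<rightarrow>\<^sub>E F :: ('d \<Rightarrow> real) set)" by (intro finite_PiE) (auto simp: F_def)
  ultimately show ?thesis by (meson finite_imageI finite_subset)
qed

text \<open>Subtracting from a representative the integral part of its coordinates with respect to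
  a basis of \<open>A(\<Gamma>)\<close> keeps it in its class and moves it into a bounded fundamental domain, which
  contains only finitely many lattice points.\<close>

lemma finite_full_representatives:
  fixes \<Gamma> :: "(real ^ 'd) set"
  assumes lat: "is_lattice \<Gamma>" and A: "invertible A" "(*v) A ` \<Gamma> \<subseteq> \<Gamma>" and D: "full_representatives \<Gamma> A D"
  shows "finite D"
proof -
  obtain M :: "real ^ 'd ^ 'd" where M: "invertible M" "\<Gamma> = (*v) M ` {z. \<forall>i. vec_nth z i \<in> \<int>}"
    using lat unfolding is_lattice_def by blast
  let ?N = "A ** M"
  define r where "r d = matrix_inv ?N *v d" for d
  define fl where "fl x = ((\<chi> i. of_int \<lfloor>vec_nth x i\<rfloor>) :: real ^ 'd)" for x :: "real ^ 'd"
  have N: "invertible ?N" using invertible_mult[OF A(1) M(1)] .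
  have Nr: "?N *v r d = d" for d
    by (simp add: r_def matrix_vector_mul_assoc matrix_inv_cancel(1)[OF N])
  have flA: "?N *v fl x \<in> (*v) A ` \<Gamma>" for x
    unfolding M(2) by (auto simp: matrix_vector_mul_assoc[symmetric] fl_def intro!: imageI)
  define g where "g d = d - ?N *v fl (r d)" for d
  have g: "g d = ?N *v (r d - fl (r d))" for d
    using Nr[of d] by (simp add: g_def matrix_vector_mult_diff_distrib)
  have DG: "D \<subseteq> \<Gamma>" using D unfolding full_representatives_def by blast
  have "g ` D \<subseteq> \<Gamma>"
    using DG flA A(2) lattice_diff[OF lat] unfolding g_def by blast
  moreover have "bounded (g ` D)"
  proof -
    have "norm (r d - fl (r d)) \<le> CARD('d)" for d
    proof -
      have "norm (r d - fl (r d)) \<le> (\<Sum>i\<in>UNIV. \<bar>vec_nth (r d - fl (r d)) i\<bar>)" by (rule norm_le_l1_cart)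
      also have "\<dots> \<le> (\<Sum>i\<in>(UNIV::'d set). 1)"
        by (rule sum_mono) (simp add: fl_def abs_le_iff; linarith)
      finally show ?thesis by simp
    qed
    then have "bounded ((\<lambda>d. r d - fl (r d)) ` D)" unfolding bounded_iff by blast
    then have "bounded ((*v) ?N ` (\<lambda>d. r d - fl (r d)) ` D)"
      by (rule bounded_linear_image) (auto intro: linear_linear)
    then show ?thesis by (simp add: g image_image)
  qed
  ultimately have "finite (g ` D)"
    using finite_lattice_Int_bounded[OF lat, of "g ` D"] by (simp add: inf_absorb2)
  moreover have "inj_on g D"
  proof
    fix d d' assume d: "d \<in> D" "d' \<in> D" "g d = g d'"
    then have "d - d' = ?N *v (fl (r d) - fl (r d'))"
      by (simp add: g_def matrix_vector_mult_diff_distrib algebra_simps)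
    also have "\<dots> \<in> (*v) A ` \<Gamma>"
      unfolding M(2) by (auto simp: matrix_vector_mul_assoc[symmetric] fl_def intro!: imageI)
    finally have "d - d' \<in> (*v) A ` \<Gamma>" .
    moreover have "d - d \<in> (*v) A ` \<Gamma>" using lattice_zero[OF lat] by (auto simp: image_iff intro!: bexI[of _ 0])
    ultimately show "d = d'" using D d DG unfolding full_representatives_def by blast
  qed
  ultimately show ?thesis by (rule finite_imageD)
qed

section \<open>Extension of generalized eigenvectors\<close>

text \<open>If the values of \<open>F(Y)\<close> on each level depend only on the values of \<open>Y\<close> on the level
  before, the iterates of \<open>F\<close> become stationary on level \<open>p\<close> after \<open>p + 1\<close> steps.\<close>

lemma causal_fixpoint:
  fixes F :: "('a \<Rightarrow> 'b) \<Rightarrow> 'a \<Rightarrow> 'b" and I :: "nat \<Rightarrow> 'a set"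
  assumes mono: "\<And>p. I p \<subseteq> I (Suc p)"
    and base: "\<And>Y Y' j. j \<in> I 0 \<Longrightarrow> F Y j = F Y' j"
    and step: "\<And>p Y Y' j. (\<forall>i\<in>I p. Y i = Y' i) \<Longrightarrow> j \<in> I (Suc p) \<Longrightarrow> F Y j = F Y' j"
  shows "\<exists>!Y. (\<forall>j\<in>(\<Union>p. I p). Y j = F Y j) \<and> (\<forall>j. j \<notin> (\<Union>p. I p) \<longrightarrow> Y j = z)"
proof -
  define S where "S p = (F ^^ p) (\<lambda>_. z)" for p
  have S_Suc: "S (Suc p) = F (S p)" for p by (simp add: S_def)
  \<comment> \<open>The index is shifted by one because the initial sequence is arbitrary even on the level \<open>I 0\<close>.\<close>
  have stable1: "\<forall>j\<in>I p. S (Suc (Suc p)) j = S (Suc p) j" for p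
  proof (induction p)
    case 0
    show ?case using base by (auto simp: S_Suc[of 0] S_Suc[of "Suc 0"])
  next
    case (Suc p)
    show ?case using step[OF Suc] by (auto simp: S_Suc[of "Suc p"] S_Suc[of "Suc (Suc p)"])
  qed
  have I_le: "I p \<subseteq> I q" if "p \<le> q" for p q using mono that by (rule lift_Suc_mono_le)
  have stable: "S (Suc (p + d)) j = S (Suc p) j" if "j \<in> I p" for p d j
  proof (induction d)
    case (Suc d)
    have "j \<in> I (p + d)" using I_le[of p "p + d"] that by auto
    then show ?case using stable1[of "p + d"] Suc by simp
  qed simp
  define Y where "Y j = (if j \<in> (\<Union>p. I p) then S (Suc (LEAST p. j \<in> I p)) j else z)" for j
  have Y: "Y j = S (Suc p) j" if j: "j \<in> I p" for p j
  proof -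
    let ?q = "LEAST p. j \<in> I p"
    have "j \<in> I ?q" "?q \<le> p" using j by (auto intro: LeastI Least_le)
    then have "S (Suc (?q + (p - ?q))) j = S (Suc ?q) j" by (intro stable)
    then show ?thesis using j \<open>?q \<le> p\<close> by (auto simp: Y_def)
  qed
  have fixed: "Y j = F Y j" if "j \<in> I p" for p j
  proof -
    have j: "j \<in> I (Suc p)" using that mono by blast
    have "F Y j = F (S (Suc p)) j" using Y by (intro step[OF _ j]) auto
    also have "\<dots> = Y j" using Y[OF j] by (simp add: S_Suc)
    finally show ?thesis by simp
  qed
  have Y_z: "\<forall>j. j \<notin> (\<Union>p. I p) \<longrightarrow> Y j = z" by (simp add: Y_def)
  have unique: "Y' = Y''"
    if Y': "(\<forall>j\<in>(\<Union>p. I p). Y' j = F Y' j) \<and> (\<forall>j. j \<notin> (\<Union>p. I p) \<longrightarrow> Y' j = z)"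
      and Y'': "(\<forall>j\<in>(\<Union>p. I p). Y'' j = F Y'' j) \<and> (\<forall>j. j \<notin> (\<Union>p. I p) \<longrightarrow> Y'' j = z)" for Y' Y''
  proof -
    have agree: "\<forall>j\<in>I p. Y' j = Y'' j" for p
    proof (induction p)
      case 0
      show ?case
      proof
        fix j assume "j \<in> I 0"
        then have "F Y' j = F Y'' j" "j \<in> (\<Union>p. I p)" by (rule base, blast)
        moreover from this have "Y' j = F Y' j" "Y'' j = F Y'' j" using Y' Y'' by blast+
        ultimately show "Y' j = Y'' j" by argo
      qed
    next
      case (Suc p)
      show ?case
      proof
        fix j assume "j \<in> I (Suc p)"
        then have "F Y' j = F Y'' j" "j \<in> (\<Union>p. I p)" by (rule step[OF Suc], blast)
        moreover from this have "Y' j = F Y' j" "Y'' j = F Y'' j" using Y' Y'' by blast+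
        ultimately show "Y' j = Y'' j" by argo
      qed
    qed
    show ?thesis
    proof
      fix j show "Y' j = Y'' j" using agree Y' Y'' by (cases "j \<in> (\<Union>p. I p)") auto
    qed
  qed
  show ?thesis
  proof (rule ex1I[of _ Y])
    show "(\<forall>j\<in>(\<Union>p. I p). Y j = F Y j) \<and> (\<forall>j. j \<notin> (\<Union>p. I p) \<longrightarrow> Y j = z)"
      (is ?Y) using fixed Y_z by blast
    fix Y' assume "(\<forall>j\<in>(\<Union>p. I p). Y' j = F Y' j) \<and> (\<forall>j. j \<notin> (\<Union>p. I p) \<longrightarrow> Y' j = z)"
    from this \<open>?Y\<close> show "Y' = Y" by (rule unique)
  qed
qed

abbreviation eigen_op :: "real ^ 'd ^ 'd \<Rightarrow> 'd seqs \<Rightarrow> (real ^ 'd) set \<Rightarrow> complex \<Rightarrow> 'd seqs \<Rightarrow> 'd seqs" where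
  "eigen_op A c I \<mu> \<equiv> (\<lambda>u j. row_op A c I u j - \<mu> * u j)"

lemma eigen_op_row_vectors: "u \<in> row_vectors I \<Longrightarrow> eigen_op A c I \<mu> u \<in> row_vectors I"
  by (simp add: row_vectors_def row_op_def)

lemma ker_pow_Suc:
  "y \<in> ker_pow A c I \<mu> (Suc k) \<longleftrightarrow> y \<in> row_vectors I \<and> eigen_op A c I \<mu> y \<in> ker_pow A c I \<mu> k"
  unfolding ker_pow_def using eigen_op_row_vectors[of y I A c \<mu>]
  by (auto simp del: funpow.simps(2) simp: funpow_Suc_right)

lemma ker_pow_0: "ker_pow A c I \<mu> 0 = {\<lambda>_. 0}"
  by (auto simp: ker_pow_def row_vectors_def)

lemma ker_pow_row_vectors: "y \<in> ker_pow A c I \<mu> k \<Longrightarrow> y \<in> row_vectors I"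
  by (simp add: ker_pow_def)

context
  fixes \<Gamma> \<Lambda> :: "(real ^ 'd) set" and A :: "real ^ 'd ^ 'd" and c :: "real ^ 'd \<Rightarrow> complex"
  assumes A_inv: "matrix_inv A ** A = Finite_Cartesian_Product.mat 1"
    and dep: "\<And>i j. i \<in> \<Gamma> \<Longrightarrow> j \<in> \<Gamma> \<Longrightarrow> A *v i - j \<notin> \<Lambda> \<Longrightarrow> c (A *v i - j) = 0"
begin

text \<open>A coefficient \<open>c(Ai - j)\<close> is nonzero only if \<open>Ai - j \<in> \<Lambda>\<close>, that is, if
  \<open>i \<in> w\<^sub>\<Lambda>({j})\<close>.\<close>

lemma row_op_local:
  assumes "w_map A \<Lambda> J \<inter> \<Gamma> \<subseteq> W" "W \<subseteq> \<Gamma>" "J \<subseteq> \<Gamma>" "j \<in> J"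
    and "\<And>i. i \<in> W \<Longrightarrow> y i = y' i"
  shows "(\<Sum>\<^sub>\<infinity>i\<in>\<Gamma>. y i * c (A *v i - j)) = (\<Sum>\<^sub>\<infinity>i\<in>W. y' i * c (A *v i - j))"
proof (rule infsum_cong_neutral)
  fix i assume i: "i \<in> \<Gamma> - W"
  have "A *v i - j \<notin> \<Lambda>"
  proof
    assume "A *v i - j \<in> \<Lambda>"
    moreover have "i = matrix_inv A *v (j + (A *v i - j))"
      by (simp add: matrix_vector_mul_assoc A_inv)
    ultimately have "i \<in> w_map A \<Lambda> J" unfolding w_map_def using assms(4) by blast
    then show False using assms(1) i by blast
  qed
  then show "y i * c (A *v i - j) = 0" using dep[of i j] i assms(3,4) by auto
qed (use assms in auto)

context
  fixes I :: "nat \<Rightarrow> (real ^ 'd) set" and \<mu> :: complex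
  assumes I_mono: "\<And>p. I p \<subseteq> I (Suc p)" and I_Un: "(\<Union>p. I p) = \<Gamma>"
    and I_0: "w_map A \<Lambda> (I 0) \<inter> \<Gamma> \<subseteq> I 0"
    and I_Suc: "\<And>p. w_map A \<Lambda> (I (Suc p)) \<inter> \<Gamma> \<subseteq> I p"
    and \<mu>: "\<mu> \<noteq> 0"
begin

lemma row_op_level:
  assumes "\<And>i. i \<in> I 0 \<Longrightarrow> y i = y' i" "j \<in> I 0"
  shows "row_op A c \<Gamma> y j = row_op A c (I 0) y' j"
  using row_op_local[OF I_0, of j y y'] I_Un assms by (auto simp: row_op_def)

text \<open>Outside \<open>I 0\<close> the equation reads \<open>Y\<^sub>j = ((YL)\<^sub>j - W\<^sub>j)/\<mu>\<close>, and \<open>(YL)\<^sub>j\<close> sees only a lower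
  level than that of \<open>j\<close>. So the solution is the fixed point of a causal map, and the compatibility
  condition on \<open>u\<close> is the same equation on \<open>I 0\<close>.\<close>

lemma solve_one_step:
  assumes W: "W \<in> row_vectors \<Gamma>" and u: "\<And>j. j \<in> I 0 \<Longrightarrow> eigen_op A c (I 0) \<mu> u j = W j"
  shows "\<exists>!Y. Y \<in> row_vectors \<Gamma> \<and> (\<forall>j\<in>I 0. Y j = u j) \<and> eigen_op A c \<Gamma> \<mu> Y = W"
proof -
  define F where "F Y j = (if j \<in> I 0 then u j else (row_op A c \<Gamma> Y j - W j) / \<mu>)" for Y j
  have ex1: "\<exists>!Y. (\<forall>j\<in>(\<Union>p. I p). Y j = F Y j) \<and> (\<forall>j. j \<notin> (\<Union>p. I p) \<longrightarrow> Y j = 0)"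
  proof (rule causal_fixpoint)
    show "I p \<subseteq> I (Suc p)" for p by (rule I_mono)
    show "F Y j = F Y' j" if "j \<in> I 0" for Y Y' j using that by (simp add: F_def)
    show "F Y j = F Y' j" if "\<forall>i\<in>I p. Y i = Y' i" "j \<in> I (Suc p)" for p Y Y' j
    proof -
      have "I p \<subseteq> \<Gamma>" "I (Suc p) \<subseteq> \<Gamma>" using I_Un by auto
      from row_op_local[OF I_Suc this that(2), of Y Y'] row_op_local[OF I_Suc this that(2), of Y' Y']
      show ?thesis using that(1) by (simp add: F_def row_op_def)
    qed
  qed
  have iff: "(\<forall>j\<in>(\<Union>p. I p). Y j = F Y j) \<and> (\<forall>j. j \<notin> (\<Union>p. I p) \<longrightarrow> Y j = 0) \<longleftrightarrow>
      Y \<in> row_vectors \<Gamma> \<and> (\<forall>j\<in>I 0. Y j = u j) \<and> eigen_op A c \<Gamma> \<mu> Y = W" (is "?l \<longleftrightarrow> ?r") for Y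
  proof
    assume l: ?l
    then have YF: "Y j = F Y j" if "j \<in> \<Gamma>" for j using that I_Un by blast
    have Yu: "\<forall>j\<in>I 0. Y j = u j"
    proof
      fix j assume j: "j \<in> I 0"
      then have "Y j = F Y j" using YF I_Un by blast
      also have "\<dots> = u j" using j by (simp add: F_def)
      finally show "Y j = u j" .
    qed
    have "eigen_op A c \<Gamma> \<mu> Y j = W j" for j
    proof (cases "j \<in> \<Gamma>")
      case True
      show ?thesis
      proof (cases "j \<in> I 0")
        case True
        then show ?thesis using row_op_level[of Y u j] Yu u by simp
      next
        case False
        then have "F Y j = (row_op A c \<Gamma> Y j - W j) / \<mu>" by (simp add: F_def)
        then have "\<mu> * Y j = row_op A c \<Gamma> Y j - W j" unfolding YF[OF True, symmetric] using \<mu> by simp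
        then show ?thesis by simp
      qed
    next
      case False
      then have "Y j = 0" "W j = 0" using l W I_Un by (auto simp: row_vectors_def)
      then show ?thesis using False by (simp add: row_op_def)
    qed
    moreover have "Y \<in> row_vectors \<Gamma>" using l unfolding I_Un row_vectors_def by blast
    ultimately show ?r using Yu by blast
  next
    assume r: ?r
    have r1: "eigen_op A c \<Gamma> \<mu> Y = W" and r2: "\<forall>j\<in>I 0. Y j = u j" and r3: "Y \<in> row_vectors \<Gamma>"
      using r by blast+
    have "Y j = F Y j" for j
    proof (cases "j \<in> I 0")
      case False
      have "row_op A c \<Gamma> Y j - \<mu> * Y j = W j" by (rule fun_cong[OF r1])
      then show ?thesis using False \<mu> by (simp add: F_def field_simps)
    qed (simp add: F_def r2)
    moreover have "\<forall>j. j \<notin> \<Gamma> \<longrightarrow> Y j = 0" using r3 unfolding row_vectors_def by blast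
    ultimately show ?l unfolding I_Un by blast
  qed
  show ?thesis using ex1 unfolding iff .
qed

text \<open>Induction on \<open>k\<close>: the vector \<open>v(T - \<mu>)\<close> lies in the kernel of the power before, and
  if \<open>W\<close> is its extension, then the extension of \<open>v\<close> is the solution of \<open>Y(L - \<mu>) = W\<close> that restricts
  to \<open>v\<close>.\<close>

proposition unique_extension:
  assumes "v \<in> ker_pow A c (I 0) \<mu> k"
  shows "\<exists>!Y. Y \<in> ker_pow A c \<Gamma> \<mu> k \<and> (\<forall>j\<in>I 0. Y j = v j)"
  using assms
proof (induction k arbitrary: v)
  case 0
  then show ?case by (auto simp: ker_pow_0)
next
  case (Suc k)
  let ?w = "eigen_op A c (I 0) \<mu> v"
  have w: "?w \<in> ker_pow A c (I 0) \<mu> k" using Suc.prems by (simp add: ker_pow_Suc)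
  obtain W where W: "W \<in> ker_pow A c \<Gamma> \<mu> k" "\<forall>j\<in>I 0. W j = ?w j"
    and W_unique: "\<And>W'. W' \<in> ker_pow A c \<Gamma> \<mu> k \<Longrightarrow> \<forall>j\<in>I 0. W' j = ?w j \<Longrightarrow> W' = W"
    using Suc.IH[OF w] by (elim ex1E conjE) blast
  have iff: "Y \<in> ker_pow A c \<Gamma> \<mu> (Suc k) \<and> (\<forall>j\<in>I 0. Y j = v j) \<longleftrightarrow>
      Y \<in> row_vectors \<Gamma> \<and> (\<forall>j\<in>I 0. Y j = v j) \<and> eigen_op A c \<Gamma> \<mu> Y = W" for Y
  proof -
    have "\<forall>j\<in>I 0. eigen_op A c \<Gamma> \<mu> Y j = ?w j" if "\<forall>j\<in>I 0. Y j = v j"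
      using row_op_level[of Y v] that by simp
    then show ?thesis unfolding ker_pow_Suc using W(1) W_unique by blast
  qed
  show ?case unfolding iff
    using W(2) by (intro solve_one_step ker_pow_row_vectors[OF W(1)]) simp
qed

end

end

section \<open>Jordan bases\<close>

text \<open>Row \<open>r\<close> of a Jordan block with eigenvalue \<open>a\<close> says that \<open>T - a\<close> sends a basis vector to
  the next one in the block, and the last one to zero.\<close>

lemma jordan_chain:
  fixes T :: "('i \<Rightarrow> complex) \<Rightarrow> 'i \<Rightarrow> complex"
  assumes "\<And>r. r < m \<Longrightarrow> T (w r) = (\<lambda>j. \<Sum>s<m. jordan_matrix n_as $$ (r, s) * w s j)"
    and "m = sum_list (map fst n_as)" and "r < m"
  shows "\<exists>\<mu> k. ((\<lambda>u j. T u j - \<mu> * u j) ^^ k) (w r) = (\<lambda>_. 0)"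
  using assms
proof (induction n_as arbitrary: w m r)
  case Nil
  then show ?case by simp
next
  case (Cons na l)
  obtain n a where na: "na = (n, a)" by (cases na)
  define m' where "m' = sum_list (map fst l)"
  have m: "m = n + m'" using Cons.prems(2) by (simp add: na m'_def)
  have J: "jordan_matrix (na # l) $$ (r, s) =
      (if r < n then if s < n then jordan_block n a $$ (r, s) else 0
       else if s < n then 0 else jordan_matrix l $$ (r - n, s - n))" if "r < m" "s < m" for r s
    using that unfolding jordan_matrix_def na m m'_def
    by (auto simp: Let_def jordan_matrix_def[symmetric])
  have split: "(\<Sum>s<m. g s) = (\<Sum>s<n. g s) + (\<Sum>s<m'. g (n + s))" for g :: "nat \<Rightarrow> complex"
    unfolding m by (induction m') (simp_all add: add.assoc)
  show ?case
  proof (cases "r < n")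
    case True
    have T: "T (w r) = (\<lambda>j. a * w r j + (if Suc r < n then w (Suc r) j else 0))" if r: "r < n" for r
    proof
      fix j
      have rm: "r < m" using r m by simp
      have "T (w r) j = (\<Sum>s<n. jordan_matrix (na # l) $$ (r, s) * w s j)
          + (\<Sum>s<m'. jordan_matrix (na # l) $$ (r, n + s) * w (n + s) j)"
        unfolding Cons.prems(1)[OF rm] split ..
      also have "(\<Sum>s<n. jordan_matrix (na # l) $$ (r, s) * w s j) =
          (\<Sum>s<n. (if s = r then a * w r j else 0) + (if s = Suc r then w (Suc r) j else 0))"
        using r rm m by (intro sum.cong) (auto simp: J)
      also have "(\<Sum>s<m'. jordan_matrix (na # l) $$ (r, n + s) * w (n + s) j) = 0"
        using r rm m by (intro sum.neutral) (auto simp: J)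
      finally show "T (w r) j = a * w r j + (if Suc r < n then w (Suc r) j else 0)"
        using r by (simp add: sum.distrib)
    qed
    have "((\<lambda>u j. T u j - a * u j) ^^ Suc d) (w r) = (\<lambda>_. 0)" if "n = r + Suc d" for d r
      using that
    proof (induction d arbitrary: r)
      case 0
      then show ?case by (simp add: T)
    next
      case (Suc d)
      have "(\<lambda>j. T (w r) j - a * w r j) = w (Suc r)" using Suc.prems by (simp add: T)
      then show ?case
        using Suc.IH[of "Suc r"] Suc.prems by (subst funpow_Suc_right) simp
    qed
    from this[of r "n - Suc r"] True show ?thesis by (metis Suc_diff_Suc add_Suc_right add_diff_inverse_nat less_imp_not_less)
  next
    case False
    have "T (w (n + q)) = (\<lambda>j. \<Sum>s<m'. jordan_matrix l $$ (q, s) * w (n + s) j)" if q: "q < m'" for q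
    proof
      fix j
      have qm: "n + q < m" using q m by simp
      have "(\<Sum>s<n. jordan_matrix (na # l) $$ (n + q, s) * w s j) = 0"
        using qm by (intro sum.neutral) (auto simp: J)
      moreover have "(\<Sum>s<m'. jordan_matrix (na # l) $$ (n + q, n + s) * w (n + s) j) =
          (\<Sum>s<m'. jordan_matrix l $$ (q, s) * w (n + s) j)"
        using qm m by (intro sum.cong) (auto simp: J)
      ultimately show "T (w (n + q)) j = (\<Sum>s<m'. jordan_matrix l $$ (q, s) * w (n + s) j)"
        unfolding Cons.prems(1)[OF qm] split by simp
    qed
    from Cons.IH[of m' "\<lambda>q. w (n + q)" "r - n", OF this m'_def] show ?thesis
      using False Cons.prems(3) m by simp
  qed
qed

lemma row_op_diff:
  assumes "finite I"
  shows "row_op A c I (\<lambda>j. u j - a * w j) = (\<lambda>j. row_op A c I u j - a * row_op A c I w j)"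
  using assms by (auto simp: row_op_def algebra_simps sum_subtractf sum_distrib_left)

lemma eigen_op_commute:
  assumes "finite I"
  shows "eigen_op A c I \<mu> ((eigen_op A c I \<nu> ^^ n) u) = (eigen_op A c I \<nu> ^^ n) (eigen_op A c I \<mu> u)"
proof (induction n)
  case (Suc n)
  have "eigen_op A c I \<mu> (eigen_op A c I \<nu> y) = eigen_op A c I \<nu> (eigen_op A c I \<mu> y)" for y
    using row_op_diff[OF assms, of A c "row_op A c I y"] by (simp add: algebra_simps)
  from this[of "(eigen_op A c I \<nu> ^^ n) u"]
  have "eigen_op A c I \<mu> ((eigen_op A c I \<nu> ^^ Suc n) u) =
      eigen_op A c I \<nu> (eigen_op A c I \<mu> ((eigen_op A c I \<nu> ^^ n) u))"
    unfolding funpow.simps comp_apply .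
  also have "\<dots> = (eigen_op A c I \<nu> ^^ Suc n) (eigen_op A c I \<mu> u)"
    unfolding funpow.simps comp_apply by (rule arg_cong[OF Suc])
  finally show ?case .
qed simp

text \<open>By induction it suffices to consider \<open>u\<close> with \<open>uT = \<mu> u\<close>, on which \<open>(T - \<nu>)\<^sup>l\<close> acts
  as multiplication by \<open>(\<mu> - \<nu>)\<^sup>l \<noteq> 0\<close>.\<close>

lemma ker_pow_disjoint:
  assumes I: "finite I" and "\<mu> \<noteq> \<nu>"
    and "u \<in> ker_pow A c I \<mu> k" "u \<in> ker_pow A c I \<nu> l"
  shows "u = (\<lambda>_. 0)"
  using assms(3,4)
proof (induction k arbitrary: u)
  case 0
  then show ?case by (simp add: ker_pow_0)
next
  case (Suc k)
  have zero: "eigen_op A c I \<mu> (\<lambda>_. 0) = (\<lambda>_. 0)" by (auto simp: row_op_def)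
  have "(eigen_op A c I \<nu> ^^ l) (eigen_op A c I \<mu> u) = (\<lambda>_. 0)"
    unfolding eigen_op_commute[OF I, symmetric] using Suc.prems(2) zero by (simp add: ker_pow_def)
  then have "eigen_op A c I \<mu> u \<in> ker_pow A c I \<nu> l"
    using eigen_op_row_vectors[OF ker_pow_row_vectors[OF Suc.prems(1)]] by (simp add: ker_pow_def)
  then have "eigen_op A c I \<mu> u = (\<lambda>_. 0)"
    using Suc.IH Suc.prems(1) by (simp add: ker_pow_Suc)
  then have eig: "row_op A c I u = (\<lambda>j. \<mu> * u j)" by (simp add: fun_eq_iff)
  have "(eigen_op A c I \<nu> ^^ n) u = (\<lambda>j. (\<mu> - \<nu>) ^ n * u j)" for n
  proof (induction n)
    case (Suc n)
    have "row_op A c I (\<lambda>j. (\<mu> - \<nu>) ^ n * u j) = (\<lambda>j. (\<mu> - \<nu>) ^ n * (\<mu> * u j))"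
      using row_op_diff[OF I, of A c "\<lambda>_. 0" "- ((\<mu> - \<nu>) ^ n)" u] eig by (simp add: row_op_def fun_eq_iff)
    then show ?case using Suc by (simp add: algebra_simps)
  qed simp
  then have "(\<lambda>j. (\<mu> - \<nu>) ^ l * u j) = (\<lambda>_. 0)" using Suc.prems(2) by (simp add: ker_pow_def)
  then show ?case using \<open>\<mu> \<noteq> \<nu>\<close> by (simp add: fun_eq_iff)
qed

lemma ker_pow_mono: "k \<le> l \<Longrightarrow> ker_pow A c I \<mu> k \<subseteq> ker_pow A c I \<mu> l"
proof (rule lift_Suc_mono_le)
  fix k
  have zero: "eigen_op A c I \<mu> (\<lambda>_. 0) = (\<lambda>_. 0)" by (auto simp: row_op_def)
  show "ker_pow A c I \<mu> k \<subseteq> ker_pow A c I \<mu> (Suc k)"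
    using zero by (auto simp: ker_pow_def)
qed

lemma row_basis_nonzero:
  assumes "row_basis I m v" "r < m"
  shows "v r \<noteq> (\<lambda>_. 0)"
proof
  assume z: "v r = (\<lambda>_. 0)"
  have "(\<lambda>_. 0) \<in> row_vectors I" by (simp add: row_vectors_def)
  define P where "P a \<longleftrightarrow> (\<forall>r\<ge>m. a r = 0) \<and> (\<lambda>_. 0) = (\<lambda>j. \<Sum>r<m. a r * v r j)" for a
  have ex1: "\<exists>!a. P a"
    using assms(1) \<open>(\<lambda>_. 0) \<in> row_vectors I\<close> unfolding row_basis_def P_def by blast
  let ?a = "\<lambda>s. if s = r then 1 else 0 :: complex"
  have "(\<Sum>s<m. ?a s * v s j) = 0" for j
    using z by (intro sum.neutral) auto
  then have "P ?a" using assms(2) by (auto simp: P_def)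
  moreover have "P (\<lambda>_. 0)" by (simp add: P_def)
  ultimately have "?a = (\<lambda>_. 0)" using ex1 by blast
  then have "?a r = 0" by (rule fun_cong)
  then show False by simp
qed

text \<open>The eigenvalue is that of the Jordan block, the exponent is the least one that kills
  the vector; they are unique because generalized eigenspaces for different eigenvalues meet only
  in zero and the kernels increase with the exponent. So the definite description denotes the pair
  that it describes.\<close>

proposition jordan_pair_in_ker_pow:
  assumes I: "finite I" and basis: "jordan_basis A c I m v" and r: "r < m"
    and pair: "jordan_pair A c I (v r) = (\<mu>, k)"
  shows "v r \<in> ker_pow A c I \<mu> k"
proof -
  have rb: "row_basis I m v" using basis unfolding jordan_basis_def by blast
  have vr: "v r \<in> row_vectors I" using rb r unfolding row_basis_def by blast
  have nz: "v r \<noteq> (\<lambda>_. 0)" using row_basis_nonzero[OF rb r] .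
  obtain n_as p where J: "sum_list (map fst n_as) = m" "p permutes {..<m}"
    "\<And>r. r < m \<Longrightarrow> row_op A c I (v (p r)) = (\<lambda>j. \<Sum>s<m. jordan_matrix n_as $$ (r, s) * v (p s) j)"
    using basis unfolding jordan_basis_def by blast
  obtain q where q: "q < m" "p q = r" using J(2) r by (metis lessThan_iff permutes_in_image permutes_surj surjD)
  obtain \<kappa> l where "((\<lambda>u j. row_op A c I u j - \<kappa> * u j) ^^ l) (v (p q)) = (\<lambda>_. 0)"
    using jordan_chain[of m "row_op A c I" "\<lambda>q. v (p q)" n_as q, OF J(3)] J(1) q(1) by metis
  then have ex: "v r \<in> ker_pow A c I \<kappa> l" using vr q(2) by (simp add: ker_pow_def)
  define k0 where "k0 = (LEAST l. v r \<in> ker_pow A c I \<kappa> l)"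
  have k0: "v r \<in> ker_pow A c I \<kappa> k0" unfolding k0_def using ex by (rule LeastI)
  have "k0 \<noteq> 0" using k0 nz by (metis ker_pow_0 singletonD)
  then obtain k1 where k1: "k0 = Suc k1" by (metis not0_implies_Suc)
  have k1': "v r \<notin> ker_pow A c I \<kappa> k1" using not_less_Least[of k1 "\<lambda>l. v r \<in> ker_pow A c I \<kappa> l"] k1 k0_def by auto
  let ?P = "\<lambda>(\<mu>, k). (\<exists>u\<in>row_vectors I. u \<noteq> (\<lambda>_. 0) \<and> row_op A c I u = (\<lambda>j. \<mu> * u j)) \<and>
     k \<ge> 1 \<and> v r \<in> ker_pow A c I \<mu> k - ker_pow A c I \<mu> (k - 1)"
  \<comment> \<open>The last nonzero vector of the chain is the eigenvector required by the definition.\<close>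
  let ?u = "(eigen_op A c I \<kappa> ^^ k1) (v r)"
  have "?u \<noteq> (\<lambda>_. 0)" using k1' vr by (simp add: ker_pow_def)
  moreover have "?u \<in> row_vectors I"
    by (induction k1) (use vr eigen_op_row_vectors in auto)
  moreover have "eigen_op A c I \<kappa> ?u = (\<lambda>_. 0)" using k0 by (simp add: k1 ker_pow_def)
  then have "row_op A c I ?u = (\<lambda>j. \<kappa> * ?u j)" by (simp add: fun_eq_iff)
  ultimately have "?P (\<kappa>, k0)" using k0 k1' k1 by auto
  moreover have "x = y" if "?P x" "?P y" for x y
  proof -
    obtain \<mu> k where x: "x = (\<mu>, k)" by (cases x)
    obtain \<nu> l where y: "y = (\<nu>, l)" by (cases y)
    have \<mu>\<nu>: "\<mu> = \<nu>" using ker_pow_disjoint[OF I, of \<mu> \<nu> "v r"] nz that unfolding x y by auto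
    have le: "ker_pow A c I \<nu> i \<subseteq> ker_pow A c I \<nu> (j - 1)" if "i < j" for i j
      using that by (intro ker_pow_mono) simp
    have "\<not> k < l" using le[of k l] that unfolding x y \<mu>\<nu> by auto
    moreover have "\<not> l < k" using le[of l k] that unfolding x y \<mu>\<nu> by auto
    ultimately show ?thesis using \<mu>\<nu> x y by simp
  qed
  ultimately have "\<exists>!x. ?P x" by blast
  then have "?P (THE x. ?P x)" by (rule theI')
  then show ?thesis using pair unfolding jordan_pair_def by auto
qed

text \<open>The rows of a left inverse are the coefficient vectors of the unit vectors with respect to
  the basis.\<close>

proposition basis_matrix_inverse:
  fixes I :: "(real ^ 'd) set"
  assumes rb: "row_basis I m v" and e: "bij_betw e {..<m} I"
  defines "B \<equiv> basis_matrix m e v"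
  shows "the (mat_inverse B) \<in> carrier_mat m m" "the (mat_inverse B) * B = 1\<^sub>m m"
proof -
  have B: "B \<in> carrier_mat m m" by (simp add: B_def basis_matrix_def)
  define \<delta> where "\<delta> s = (\<lambda>j. if j = e s then 1 else 0 :: complex)" for s
  have "\<exists>a. \<delta> s = (\<lambda>j. \<Sum>r<m. a r * v r j)" if "s < m" for s
  proof -
    have "\<delta> s \<in> row_vectors I" using that e by (auto simp: \<delta>_def row_vectors_def bij_betw_def)
    then show ?thesis using rb unfolding row_basis_def by blast
  qed
  then obtain a where a: "\<And>s. s < m \<Longrightarrow> \<delta> s = (\<lambda>j. \<Sum>r<m. a s r * v r j)" by metis
  let ?C = "Matrix.mat m m (\<lambda>(s, r). a s r)"
  have CB: "?C * B = 1\<^sub>m m"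
  proof (rule eq_matI)
    fix s t assume "s < dim_row (1\<^sub>m m :: complex mat)" "t < dim_col (1\<^sub>m m :: complex mat)"
    then have st: "s < m" "t < m" by auto
    then have "(?C * B) $$ (s, t) = (\<Sum>r<m. a s r * v r (e t))"
      by (simp add: B_def basis_matrix_def scalar_prod_def lessThan_atLeast0)
    also have "\<dots> = \<delta> s (e t)" using a[OF st(1)] by simp
    also have "\<dots> = 1\<^sub>m m $$ (s, t)"
      using st e by (auto simp: \<delta>_def bij_betw_def inj_on_def)
    finally show "(?C * B) $$ (s, t) = 1\<^sub>m m $$ (s, t)" .
  qed (auto simp: B_def basis_matrix_def)
  have "B * ?C = 1\<^sub>m m" by (rule mat_mult_left_right_inverse[OF _ B CB]) simp
  then have "B \<in> Units (ring_mat TYPE(complex) m ())"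
    using B CB unfolding Units_def ring_mat_def by (auto intro!: bexI[of _ ?C])
  then obtain B' where "mat_inverse B = Some B'" using mat_inverse(1)[OF B, where b = "()"] by (cases "mat_inverse B") auto
  then show "the (mat_inverse B) \<in> carrier_mat m m" "the (mat_inverse B) * B = 1\<^sub>m m"
    using mat_inverse(2)[OF B] by auto
qed

section \<open>Expansion on the tile\<close>

text \<open>By the refinement equation the support \<open>S\<close> of \<open>\<phi>\<close> satisfies \<open>S \<subseteq> w\<^sub>\<Lambda>(S)\<close>,
  and \<open>Q \<subseteq> w\<^sub>D(Q)\<close>. Subtracting the digits, \<open>S - Q \<subseteq> w\<^sub>H(S - Q)\<close> for \<open>H = \<Lambda> - D\<close>, so this bounded
  set lies in the attractor of \<open>\<Lambda> - D\<close>.\<close>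

lemma difference_with_tile_in_attractor:
  assumes dil: "is_dilation \<Gamma> A" and \<Lambda>: "finite \<Lambda>" "\<Lambda> \<noteq> {}" and D: "finite D" "D \<noteq> {}"
    and supp: "bounded {x. \<phi> x \<noteq> (0 :: complex)}"
    and refinable: "\<And>x. \<phi> x = (\<Sum>k\<in>\<Lambda>. c k * \<phi> (A *v x - k))"
    and s: "\<phi> s \<noteq> 0" and q: "q \<in> attractor A D"
  shows "s - q \<in> attractor A {k - d | k d. k \<in> \<Lambda> \<and> d \<in> D}"
proof -
  let ?\<Lambda>' = "{k - d | k d. k \<in> \<Lambda> \<and> d \<in> D}"
  let ?S = "{x. \<phi> x \<noteq> 0}" and ?Q = "attractor A D"
  define T where "T = {s - q | s q. s \<in> ?S \<and> q \<in> ?Q}"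
  have inv: "matrix_inv A ** A = Finite_Cartesian_Product.mat 1"
    using matrix_inv_cancel(2)[OF dilation_invertible(1)[OF dil]] .
  have Q: "bounded ?Q" "w_map A D ?Q = ?Q" using attractor_eq_Union_self_covering[OF dil D] by simp_all
  have S_cover: "\<exists>s' k. s' \<in> ?S \<and> k \<in> \<Lambda> \<and> s = matrix_inv A *v (s' + k)" if "s \<in> ?S" for s
  proof -
    have "(\<Sum>k\<in>\<Lambda>. c k * \<phi> (A *v s - k)) \<noteq> 0" using that refinable[of s] by auto
    then obtain k where k: "k \<in> \<Lambda>" "c k * \<phi> (A *v s - k) \<noteq> 0" by (meson sum.not_neutral_contains_not_neutral)
    have "s = matrix_inv A *v ((A *v s - k) + k)" by (simp add: matrix_vector_mul_assoc inv)
    then show ?thesis using k by (intro exI[of _ "A *v s - k"] exI[of _ k]) auto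
  qed
  have "T \<subseteq> w_map A ?\<Lambda>' T"
  proof
    fix t assume "t \<in> T"
    then obtain s q where t: "t = s - q" "s \<in> ?S" "q \<in> ?Q" unfolding T_def by blast
    obtain s' k where s': "s' \<in> ?S" "k \<in> \<Lambda>" "s = matrix_inv A *v (s' + k)" using S_cover[OF t(2)] by blast
    obtain q' d where q': "q' \<in> ?Q" "d \<in> D" "q = matrix_inv A *v (q' + d)"
      using t(3) Q(2) unfolding w_map_def by blast
    have "t = matrix_inv A *v ((s' - q') + (k - d))"
      unfolding t(1) s'(3) q'(3) by (simp add: matrix_vector_mult_diff_distrib[symmetric] algebra_simps)
    moreover have "s' - q' \<in> T" using s'(1) q'(1) unfolding T_def by blast
    moreover have "k - d \<in> ?\<Lambda>'" using s'(2) q'(2) by blast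
    ultimately show "t \<in> w_map A ?\<Lambda>' T" unfolding w_map_def by blast
  qed
  moreover have "bounded T"
  proof -
    obtain a where a: "\<And>x. x \<in> ?S \<Longrightarrow> norm x \<le> a" using supp unfolding bounded_iff by blast
    obtain b where b: "\<And>x. x \<in> ?Q \<Longrightarrow> norm x \<le> b" using Q(1) unfolding bounded_iff by blast
    have "norm (s - q) \<le> a + b" if "s \<in> ?S" "q \<in> ?Q" for s q
      using a[OF that(1)] b[OF that(2)] norm_triangle_ineq4[of s q] by linarith
    then show ?thesis unfolding T_def by (intro boundedI[of _ "a + b"]) blast
  qed
  moreover have "finite ?\<Lambda>'" "?\<Lambda>' \<noteq> {}"
    using finite_image_set2[of "\<lambda>k. k \<in> \<Lambda>" "\<lambda>d. d \<in> D" "(-)"] \<Lambda> D by simp_all blast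
  note attr = attractor_eq_Union_self_covering(1)[OF dil this]
  ultimately have "T \<subseteq> attractor A ?\<Lambda>'"
    unfolding attr by (intro Union_upper CollectI conjI)
  moreover have "s - q \<in> T" using s q unfolding T_def by blast
  ultimately show ?thesis by blast
qed

lemma shift_comb_local:
  assumes "finite W" "W \<subseteq> \<Gamma>" "\<And>k. k \<in> \<Gamma> \<Longrightarrow> k \<notin> W \<Longrightarrow> \<phi> (x + k) = 0"
  shows "shift_comb \<Gamma> Y \<phi> x = (\<Sum>k\<in>W. Y k * \<phi> (x + k))"
proof -
  have "shift_comb \<Gamma> Y \<phi> x = (\<Sum>\<^sub>\<infinity>k\<in>W. Y k * \<phi> (x + k))"
    unfolding shift_comb_def by (rule infsum_cong_neutral) (use assms in auto)
  then show ?thesis using assms(1) by simp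
qed

text \<open>The vector on the left is the row vector \<open>a C\<close>, and \<open>a C B p = a p\<close>.\<close>

lemma scalar_prod_inverse_cancel:
  assumes C: "C \<in> carrier_mat m m" and B: "B \<in> carrier_mat m m" and CB: "C * B = 1\<^sub>m m"
    and a: "a \<in> carrier_vec m" and p: "(p :: complex Matrix.vec) \<in> carrier_vec m"
  shows "scalar_prod (Matrix.vec m (\<lambda>s. scalar_prod a (col C s))) (B *\<^sub>v p) = scalar_prod a p"
proof -
  have adjoint: "scalar_prod (Matrix.vec m (\<lambda>s. scalar_prod a (col C s))) w = scalar_prod a (C *\<^sub>v w)"
    if w: "w \<in> carrier_vec m" for w
  proof -
    have "scalar_prod (Matrix.vec m (\<lambda>s. scalar_prod a (col C s))) w =
        (\<Sum>s<m. \<Sum>t<m. vec_index a t * C $$ (t, s) * vec_index w s)"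
      using a C w by (simp add: scalar_prod_def lessThan_atLeast0 sum_distrib_right)
    also have "\<dots> = (\<Sum>t<m. \<Sum>s<m. vec_index a t * C $$ (t, s) * vec_index w s)" by (rule sum.swap)
    also have "\<dots> = scalar_prod a (C *\<^sub>v w)"
      using a C w by (simp add: scalar_prod_def lessThan_atLeast0 sum_distrib_left mult.assoc)
    finally show ?thesis .
  qed
  have "C *\<^sub>v (B *\<^sub>v p) = p" using assoc_mult_mat_vec[OF C B p] CB p by simp
  then show ?thesis using adjoint[OF mult_mat_vec_carrier[OF B p]] by simp
qed

theorem mainTheorem5:
  fixes \<Gamma> \<Lambda> \<Lambda>' D Q :: "(real ^ 'd) set" and A :: "real ^ 'd ^ 'd"
    and c \<phi> f \<alpha> :: "real ^ 'd \<Rightarrow> complex"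
    and \<Omega> :: "nat \<Rightarrow> (real ^ 'd) set" and n\<^sub>0 n m :: nat
    and e :: "nat \<Rightarrow> real ^ 'd" and v :: "nat \<Rightarrow> real ^ 'd \<Rightarrow> complex"
  assumes lattice: "is_lattice \<Gamma>"
    and dilation: "is_dilation \<Gamma> A"
    and Lambda: "finite \<Lambda>" "\<Lambda> \<noteq> {}" "\<Lambda> \<subseteq> \<Gamma>"
    and coeffs: "\<forall>k\<in>\<Gamma> - \<Lambda>. c k = 0"
    and phi_supp: "compact (closure {x. \<phi> x \<noteq> 0})"
    and refinable: "\<forall>x. \<phi> x = (\<Sum>k\<in>\<Lambda>. c k * \<phi> (A *v x - k))"
    and D: "full_representatives \<Gamma> A D" "0 \<in> D"
    and Q: "Q = attractor A D" "is_tile \<Gamma> Q"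
    and Lambda': "\<Lambda>' = {k - d | k d. k \<in> \<Lambda> \<and> d \<in> D}"
    and Omega_finite: "\<forall>i. finite (\<Omega> i) \<and> \<Omega> i \<subseteq> \<Gamma>"
    and Omega_0: "\<Omega> 0 = attractor A \<Lambda> \<inter> \<Gamma>"
    and Omega_mono: "\<forall>i. \<Omega> i \<subset> \<Omega> (Suc i)"
    and Omega_union: "(\<Union>i. \<Omega> i) = \<Gamma>"
    and Omega_adm: "\<forall>i. admissible \<Gamma> A \<Lambda> (\<Omega> i) \<and> w_map A \<Lambda> (\<Omega> (Suc i)) \<inter> \<Gamma> \<subseteq> \<Omega> i"
    and Omega_n0: "\<Omega> n\<^sub>0 = attractor A \<Lambda>' \<inter> \<Gamma>"
    and Omega_adm': "\<forall>i\<ge>n\<^sub>0. admissible \<Gamma> A \<Lambda>' (\<Omega> i) \<and> w_map A \<Lambda>' (\<Omega> (Suc i)) \<inter> \<Gamma> \<subseteq> \<Omega> i"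
    and n: "n \<ge> n\<^sub>0"
    and enum: "m = card (\<Omega> n)" "bij_betw e {..<m} (\<Omega> n)"
    and jordan: "jordan_basis A c (\<Omega> n) m v"
    and f: "f \<in> shift_space \<Gamma> \<phi>" "f = shift_comb \<Gamma> \<alpha> \<phi>"
  shows "(\<forall>x. x \<notin> tile_overlap \<Gamma> Q \<longrightarrow>
            ((\<lambda>\<gamma>. scalar_prod (beta_vec m e v \<alpha> \<gamma>) (h_vec A c \<Gamma> \<phi> Q (\<Omega> n) m v (x + \<gamma>)))
               has_sum f x) \<Gamma>) \<and>
         (AE x in lebesgue.
            ((\<lambda>\<gamma>. scalar_prod (beta_vec m e v \<alpha> \<gamma>) (h_vec A c \<Gamma> \<phi> Q (\<Omega> n) m v (x + \<gamma>)))
               has_sum f x) \<Gamma>)"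
proof -
  have inv: "invertible A" using dilation_invertible(1)[OF dilation] .
  have A\<Gamma>: "(*v) A ` \<Gamma> \<subseteq> \<Gamma>" using dilation unfolding is_dilation_def by blast
  have D_fin: "finite D" using finite_full_representatives[OF lattice inv A\<Gamma> D(1)] .
  have W: "finite (\<Omega> n)" "\<Omega> n \<subseteq> \<Gamma>" using Omega_finite by auto
  have "bounded (closure {x. \<phi> x \<noteq> 0})" using phi_supp by (rule compact_imp_bounded)
  then have supp: "bounded {x. \<phi> x \<noteq> 0}" using closure_subset by (rule bounded_subset)
  have Omega_le: "\<Omega> i \<subseteq> \<Omega> j" if "i \<le> j" for i j
    using that by (rule lift_Suc_mono_le[rotated]) (use Omega_mono in blast)
  \<comment> \<open>On the tile only the translates of \<open>\<phi>\<close> indexed by \<open>\<Omega>\<^sub>n\<close> can be nonzero.\<close>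
  have in_Omega: "k \<in> \<Omega> n" if "y \<in> Q" "k \<in> \<Gamma>" "\<phi> (y + k) \<noteq> 0" for y k
  proof -
    have "(y + k) - y \<in> attractor A \<Lambda>'"
      unfolding Lambda' using D(2) that
      by (intro difference_with_tile_in_attractor[OF dilation Lambda(1,2) D_fin _ supp refinable[rule_format]])
         (auto simp: Q(1))
    then show ?thesis using that(2) Omega_n0 Omega_le[OF n] by auto
  qed
  have extension: "\<exists>!Y. Y \<in> ker_pow A c \<Gamma> \<mu> k \<and> (\<forall>j\<in>\<Omega> n. Y j = u j)"
    if "\<mu> \<noteq> 0" "u \<in> ker_pow A c (\<Omega> n) \<mu> k" for \<mu> k u
  proof -
    have dep: "c (A *v i - j) = 0" if "i \<in> \<Gamma>" "j \<in> \<Gamma>" "A *v i - j \<notin> \<Lambda>" for i j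
      using that coeffs A\<Gamma> lattice_diff[OF lattice, of "A *v i" j] by blast
    have Un: "(\<Union>p. \<Omega> (n + p)) = \<Gamma>"
    proof -
      have "\<Omega> i \<subseteq> \<Omega> (n + i)" for i by (rule Omega_le) simp
      then show ?thesis using Omega_union Omega_finite by blast
    qed
    define I where "I p = \<Omega> (n + p)" for p
    have "\<exists>!Y. Y \<in> ker_pow A c \<Gamma> \<mu> k \<and> (\<forall>j\<in>I 0. Y j = u j)"
    proof (rule unique_extension[where \<Lambda> = \<Lambda>])
      show "matrix_inv A ** A = Finite_Cartesian_Product.mat 1" using matrix_inv_cancel(2)[OF inv] .
      show "\<And>i j. i \<in> \<Gamma> \<Longrightarrow> j \<in> \<Gamma> \<Longrightarrow> A *v i - j \<notin> \<Lambda> \<Longrightarrow> c (A *v i - j) = 0" by (rule dep)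
      show "\<And>p. I p \<subseteq> I (Suc p)" unfolding I_def by (rule Omega_le) simp
      show "(\<Union>p. I p) = \<Gamma>" unfolding I_def by (rule Un)
      show "w_map A \<Lambda> (I 0) \<inter> \<Gamma> \<subseteq> I 0" "\<And>p. w_map A \<Lambda> (I (Suc p)) \<inter> \<Gamma> \<subseteq> I p"
        using Omega_adm by (auto simp: I_def admissible_def)
      show "\<mu> \<noteq> 0" by fact
      show "u \<in> ker_pow A c (I 0) \<mu> k" using that(2) by (simp add: I_def)
    qed
    then show ?thesis by (simp add: I_def)
  qed
  let ?B = "basis_matrix m e v"
  have rb: "row_basis (\<Omega> n) m v" using jordan unfolding jordan_basis_def by blast
  \<comment> \<open>Therefore on the tile only the entries of an extension on \<open>\<Omega>\<^sub>n\<close> matter, and those are the ones of the basis vector.\<close>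
  have jordan_fun: "jordan_fun A c \<Gamma> \<phi> (\<Omega> n) (v r) y = (\<Sum>i\<in>\<Omega> n. v r i * \<phi> (y + i))"
    if r: "r < m" and y: "y \<in> Q" for r y
  proof -
    obtain \<mu> k where pair: "jordan_pair A c (\<Omega> n) (v r) = (\<mu>, k)" by (cases "jordan_pair A c (\<Omega> n) (v r)")
    show ?thesis
    proof (cases "\<mu> = 0")
      case False
      have "v r \<in> ker_pow A c (\<Omega> n) \<mu> k" using jordan_pair_in_ker_pow[OF W(1) jordan r pair] .
      then have "\<forall>j\<in>\<Omega> n. row_extension A c \<Gamma> (\<Omega> n) \<mu> k (v r) j = v r j"
        unfolding row_extension_def using theI'[OF extension[OF False]] by blast
      moreover have "shift_comb \<Gamma> Y \<phi> y = (\<Sum>k\<in>\<Omega> n. Y k * \<phi> (y + k))" for Y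
        using W in_Omega[OF y] by (intro shift_comb_local) auto
      ultimately show ?thesis using False pair by (simp add: jordan_fun_def)
    qed (simp add: jordan_fun_def pair)
  qed
  have main: "((\<lambda>\<gamma>. scalar_prod (beta_vec m e v \<alpha> \<gamma>) (h_vec A c \<Gamma> \<phi> Q (\<Omega> n) m v (x + \<gamma>))) has_sum f x) \<Gamma>"
    if x: "x \<notin> tile_overlap \<Gamma> Q" for x
  proof -
    have "x \<in> (\<Union>k\<in>\<Gamma>. (+) k ` Q)" using Q(2) unfolding is_tile_def by blast
    then obtain k q where kq: "k \<in> \<Gamma>" "q \<in> Q" "x = k + q" by blast
    \<comment> \<open>Off the overlaps, \<open>x + \<gamma>\<close> lies in the tile for this \<open>\<gamma>\<close> only.\<close>
    define \<gamma> where "\<gamma> = - k"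
    have \<gamma>: "\<gamma> \<in> \<Gamma>" "x + \<gamma> \<in> Q" using kq lattice_uminus[OF lattice] by (auto simp: \<gamma>_def)
    have only: "x + \<delta> \<notin> Q" if "\<delta> \<in> \<Gamma>" "\<delta> \<noteq> \<gamma>" for \<delta>
    proof
      assume "x + \<delta> \<in> Q"
      then have "x \<in> (+) (- \<delta>) ` Q" by (intro image_eqI[of _ _ "x + \<delta>"]) auto
      moreover have "x \<in> (+) k ` Q" "k \<noteq> - \<delta>" using kq that by (auto simp: \<gamma>_def)
      ultimately show False
        using x kq(1) lattice_uminus[OF lattice that(1)] unfolding tile_overlap_def by blast
    qed
    let ?p = "Matrix.vec m (\<lambda>s. \<phi> (x + \<gamma> + e s))"
    have "h_vec A c \<Gamma> \<phi> Q (\<Omega> n) m v (x + \<gamma>) = ?B *\<^sub>v ?p"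
    proof (rule eq_vecI)
      fix r assume "r < dim_vec (?B *\<^sub>v ?p)"
      then have r: "r < m" by (simp add: basis_matrix_def)
      have "(\<Sum>i\<in>\<Omega> n. v r i * \<phi> (x + \<gamma> + i)) = (\<Sum>s<m. v r (e s) * \<phi> (x + \<gamma> + e s))"
        using sum.reindex_bij_betw[OF enum(2), of "\<lambda>i. v r i * \<phi> (x + \<gamma> + i)"] by simp
      then show "vec_index (h_vec A c \<Gamma> \<phi> Q (\<Omega> n) m v (x + \<gamma>)) r = vec_index (?B *\<^sub>v ?p) r"
        using r \<gamma>(2) jordan_fun[OF r \<gamma>(2)]
        by (simp add: h_vec_def basis_matrix_def scalar_prod_def lessThan_atLeast0)
    qed (simp_all add: h_vec_def basis_matrix_def)
    then have "scalar_prod (beta_vec m e v \<alpha> \<gamma>) (h_vec A c \<Gamma> \<phi> Q (\<Omega> n) m v (x + \<gamma>)) =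
        scalar_prod (alpha_vec m e \<alpha> \<gamma>) ?p"
      unfolding beta_vec_def
      using scalar_prod_inverse_cancel[OF basis_matrix_inverse(1)[OF rb enum(2)] _ basis_matrix_inverse(2)[OF rb enum(2)],
          of "alpha_vec m e \<alpha> \<gamma>" ?p]
      by (simp add: alpha_vec_def basis_matrix_def)
    also have "\<dots> = (\<Sum>s<m. \<alpha> (e s + \<gamma>) * \<phi> (x + \<gamma> + e s))"
      by (simp add: scalar_prod_def alpha_vec_def lessThan_atLeast0)
    also have "\<dots> = (\<Sum>i\<in>\<Omega> n. \<alpha> (i + \<gamma>) * \<phi> (x + \<gamma> + i))"
      by (rule sum.reindex_bij_betw[OF enum(2)])
    also have "\<dots> = (\<Sum>k\<in>(\<lambda>i. i + \<gamma>) ` \<Omega> n. \<alpha> k * \<phi> (x + k))"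
      by (subst sum.reindex) (auto simp: inj_on_def algebra_simps)
    also have "\<dots> = f x"
    proof -
      have "\<phi> (x + k) = 0" if k: "k \<in> \<Gamma>" "k \<notin> (\<lambda>i. i + \<gamma>) ` \<Omega> n" for k
      proof (rule ccontr)
        assume "\<phi> (x + k) \<noteq> 0"
        then have "k - \<gamma> \<in> \<Omega> n"
          using in_Omega[OF \<gamma>(2), of "k - \<gamma>"] lattice_diff[OF lattice k(1) \<gamma>(1)] by simp
        then show False using k(2) by (metis diff_add_cancel image_eqI)
      qed
      moreover have "(\<lambda>i. i + \<gamma>) ` \<Omega> n \<subseteq> \<Gamma>" using W(2) lattice_add[OF lattice _ \<gamma>(1)] by blast
      ultimately show ?thesis unfolding f(2) using W(1) by (intro shift_comb_local[symmetric]) auto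
    qed
    finally have value_\<gamma>: "scalar_prod (beta_vec m e v \<alpha> \<gamma>) (h_vec A c \<Gamma> \<phi> Q (\<Omega> n) m v (x + \<gamma>)) = f x" .
    have vanish: "scalar_prod (beta_vec m e v \<alpha> \<delta>) (h_vec A c \<Gamma> \<phi> Q (\<Omega> n) m v (x + \<delta>)) = 0"
      if "\<delta> \<in> \<Gamma>" "\<delta> \<noteq> \<gamma>" for \<delta>
      using only[OF that] by (simp add: scalar_prod_def h_vec_def)
    show ?thesis
      using \<gamma>(1) vanish value_\<gamma>
      by (subst has_sum_cong_neutral[where S = \<Gamma> and T = "{\<gamma>}" and
            g = "\<lambda>\<gamma>. scalar_prod (beta_vec m e v \<alpha> \<gamma>) (h_vec A c \<Gamma> \<phi> Q (\<Omega> n) m v (x + \<gamma>))"])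
         (auto intro: has_sum_finiteI)
  qed
  moreover have "AE x in lebesgue. x \<notin> tile_overlap \<Gamma> Q"
    using Q(2) AE_not_in unfolding is_tile_def by blast
  ultimately show ?thesis by (auto elim: eventually_mono)
qed

end
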